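(* Let $\{D(t):t\ge 0\}$ be a growing family of bounded domains in $\mathbb{C}$ with smooth analytic boundaries such that $$\frac{d}{dt}\,\mathrm{area}(D(t))\Big|_{t=t_0}=0$$ at some time $t_0$. Then no elliptic growth of Laplace–Beltrami type can drive the dynamics; that is, there are no permeability $\lambda$ and singularity $w$ for which $\{D(t)\}$ is an elliptic growth process via the operator $\nabla\lambda\nabla$ with singularity $w$.
   Context: $\nabla\lambda\nabla$ abbreviates $\nabla\cdot(\lambda\nabla)$. Elliptic growth of Laplace–Beltrami type with permeability $\lambda$ and singularity $w$: $\lambda>0$ is a smooth real function on an open set containing the closures of all the domains, $w\in\bigcap_t D(t)$, and the outward normal velocity $v_n$ of $\partial D(t)$ satisfies $v_n=\lambda\,\partial_n g_w$ on $\partial D(t)$ for every $t$. Here $g_w$ is the Green function of $\nabla\lambda\nabla$ on $D(t)$, with $\nabla\lambda\nabla g_w=\delta_w$ in $D(t)$ and $g_w=0$ on $\partial D(t)$, and $\partial_n$ is the outward normal derivative. "Growing" means nested increasing in $t$. *)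

theory Defs
  imports "HOL-Analysis.Analysis"
begin

text \<open>Real-valued functions on the plane. Directional derivatives are taken from the Frechet
  derivative; the partial derivatives with respect to $x$ and $y$ are those in the directions
  \<open>1\<close> and \<open>\<i>\<close>.\<close>

definition dir_deriv :: "complex \<Rightarrow> (complex \<Rightarrow> real) \<Rightarrow> complex \<Rightarrow> real" where
  "dir_deriv v f z = frechet_derivative f (at z) v"

text \<open>On an open set, differentiability of all iterated directional derivatives is the same as
  being infinitely differentiable (each of them is then continuous, being differentiable).\<close>

definition smooth_on :: "complex set \<Rightarrow> (complex \<Rightarrow> real) \<Rightarrow> bool" where
  "smooth_on S f \<longleftrightarrow> open S \<and> (\<forall>vs. foldr dir_deriv vs f differentiable_on S)"

text \<open>The operator $\nabla\cdot(\kappa\nabla f)$.\<close>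

definition div_grad :: "(complex \<Rightarrow> real) \<Rightarrow> (complex \<Rightarrow> real) \<Rightarrow> complex \<Rightarrow> real" where
  "div_grad \<kappa> f z =
     dir_deriv 1 (\<lambda>u. \<kappa> u * dir_deriv 1 f u) z + dir_deriv \<i> (\<lambda>u. \<kappa> u * dir_deriv \<i> f u) z"

definition test_function :: "complex set \<Rightarrow> (complex \<Rightarrow> real) \<Rightarrow> bool" where
  "test_function D f \<longleftrightarrow>
     smooth_on UNIV f \<and> (\<exists>K. compact K \<and> K \<subseteq> D \<and> (\<forall>z. z \<notin> K \<longrightarrow> f z = 0))"

text \<open>The equation $\nabla\cdot(\kappa\nabla g)=\delta_w$ in \<open>D\<close>, in the sense of distributions,
  for a locally integrable \<open>g\<close>; the operator is formally self-adjoint.\<close>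

definition solves_delta ::
  "(complex \<Rightarrow> real) \<Rightarrow> complex set \<Rightarrow> complex \<Rightarrow> (complex \<Rightarrow> real) \<Rightarrow> bool" where
  "solves_delta \<kappa> D w g \<longleftrightarrow>
     (\<forall>K. compact K \<and> K \<subseteq> D \<longrightarrow> g absolutely_integrable_on K) \<and>
     (\<forall>f. test_function D f \<longrightarrow> (LINT z:D|lebesgue. g z * div_grad \<kappa> f z) = f w)"

text \<open>Continuous differentiability up to the boundary: the gradient exists on \<open>S\<close>, relative to
  \<open>S\<close>, and is continuous there.\<close>

definition C1_on :: "complex set \<Rightarrow> (complex \<Rightarrow> real) \<Rightarrow> bool" where
  "C1_on S g \<longleftrightarrow>
     (\<exists>G. continuous_on S G \<and> (\<forall>z\<in>S. (g has_derivative (\<lambda>h. G z \<bullet> h)) (at z within S)))"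

text \<open>The value of \<open>g\<close> at \<open>w\<close> itself is irrelevant. For a domain with analytic boundary and a
  positive smooth \<open>\<kappa>\<close> the regularity of \<open>g\<close> up to the boundary is automatic (elliptic regularity);
  it is part of the definition so that the normal derivative of \<open>g\<close> is meaningful on the
  boundary.\<close>

definition green_function ::
  "(complex \<Rightarrow> real) \<Rightarrow> complex set \<Rightarrow> complex \<Rightarrow> (complex \<Rightarrow> real) \<Rightarrow> bool" where
  "green_function \<kappa> D w g \<longleftrightarrow>
     solves_delta \<kappa> D w g \<and> C1_on (closure D - {w}) g \<and> (\<forall>z\<in>frontier D. g z = 0)"

text \<open>A univalent analytic map straightening the boundary of \<open>D\<close> near \<open>p\<close> to the real axis, with
  \<open>D\<close> on the side of the upper half-plane.\<close>

definition boundary_chart ::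
  "complex set \<Rightarrow> complex \<Rightarrow> complex set \<Rightarrow> (complex \<Rightarrow> complex) \<Rightarrow> bool" where
  "boundary_chart D p U \<phi> \<longleftrightarrow>
     open U \<and> p \<in> U \<and> \<phi> holomorphic_on U \<and> inj_on \<phi> U \<and> D \<inter> U = {z \<in> U. Im (\<phi> z) > 0}"

definition analytic_boundary :: "complex set \<Rightarrow> bool" where
  "analytic_boundary D \<longleftrightarrow> (\<forall>p\<in>frontier D. \<exists>U \<phi>. boundary_chart D p U \<phi>)"

definition bounded_analytic_domain :: "complex set \<Rightarrow> bool" where
  "bounded_analytic_domain D \<longleftrightarrow>
     open D \<and> connected D \<and> D \<noteq> {} \<and> bounded D \<and> analytic_boundary D"

text \<open>The gradient of $\mathrm{Im}\,\phi$ is $i\,\overline{\phi'}$, and it points into \<open>D\<close>.\<close>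

definition outward_unit_normal :: "complex set \<Rightarrow> complex \<Rightarrow> complex \<Rightarrow> bool" where
  "outward_unit_normal D p n \<longleftrightarrow>
     (\<exists>U \<phi>. boundary_chart D p U \<phi> \<and> n = - sgn (\<i> * cnj (deriv \<phi> p)))"

text \<open>Derivative in the direction \<open>n\<close> at a boundary point, taken from inside the domain.\<close>

definition has_normal_derivative ::
  "(complex \<Rightarrow> real) \<Rightarrow> complex \<Rightarrow> complex \<Rightarrow> real \<Rightarrow> bool" where
  "has_normal_derivative g p n d \<longleftrightarrow>
     ((\<lambda>x. g (p + of_real x * n)) has_real_derivative d) (at 0 within {..0})"

text \<open>Near \<open>p\<close>, the domain \<open>D s\<close> meets the normal line to the boundary of \<open>D t\<close> at \<open>p\<close> in the part
  behind the moving boundary point \<open>p + \<delta> s * n\<close>; the normal velocity is the derivative of the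
  displacement \<open>\<delta>\<close> at time \<open>t\<close> (one-sided at time 0).\<close>

definition has_normal_velocity ::
  "(real \<Rightarrow> complex set) \<Rightarrow> real \<Rightarrow> complex \<Rightarrow> complex \<Rightarrow> real \<Rightarrow> bool" where
  "has_normal_velocity D t p n v \<longleftrightarrow>
     (\<exists>r>0. \<exists>\<delta>. \<delta> t = 0 \<and> (\<delta> has_real_derivative v) (at t within {0..}) \<and>
        (\<forall>\<^sub>F s in at t within {0..}.
           \<forall>x. \<bar>x\<bar> < r \<longrightarrow> (p + of_real x * n \<in> D s \<longleftrightarrow> x < \<delta> s)))"

definition permeability :: "(real \<Rightarrow> complex set) \<Rightarrow> (complex \<Rightarrow> real) \<Rightarrow> bool" where
  "permeability D \<kappa> \<longleftrightarrow>
     (\<exists>\<Omega>. open \<Omega> \<and> (\<forall>t\<ge>0. closure (D t) \<subseteq> \<Omega>) \<and> smooth_on \<Omega> \<kappa> \<and> (\<forall>z\<in>\<Omega>. \<kappa> z > 0))"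

text \<open>Elliptic growth of Laplace--Beltrami type with permeability \<open>\<kappa>\<close> and singularity \<open>w\<close>:
  $v_n=\kappa\,\partial_n g_w$ on the boundary at all times.\<close>

definition elliptic_growth ::
  "(real \<Rightarrow> complex set) \<Rightarrow> (complex \<Rightarrow> real) \<Rightarrow> complex \<Rightarrow> bool" where
  "elliptic_growth D \<kappa> w \<longleftrightarrow>
     permeability D \<kappa> \<and> (\<forall>t\<ge>0. w \<in> D t) \<and>
     (\<forall>t\<ge>0. \<exists>g. green_function \<kappa> (D t) w g \<and>
        (\<forall>p\<in>frontier (D t). \<exists>n v d. outward_unit_normal (D t) p n \<and>
           has_normal_velocity D t p n v \<and> has_normal_derivative g p n d \<and> v = \<kappa> p * d))"

end

theory Submission
  imports Defs "HOL-Complex_Analysis.Complex_Analysis"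
begin

text \<open>
  Let \<open>g\<close> be the Green function at time \<open>t0\<close> and \<open>V = \<kappa> \<partial>\<^sub>n g\<close> the normal velocity. The velocities are
  nonnegative because the family grows. If \<open>V\<close> were positive at some boundary point, it would exceed a
  constant \<open>c > 0\<close> along an arc, and \<open>D (t0 + h) - D t0\<close> would contain most of a strip of width \<open>c h\<close>
  along that arc; since the velocity exists only pointwise, "most" comes from an exhaustion by measurable
  sets. This contradicts the vanishing derivative of the area, so \<open>V = 0\<close> on the whole boundary, and
  with \<open>g = 0\<close> there the full gradient of \<open>g\<close> vanishes on the boundary.

  Hence \<open>g = o(dist)\<close> at the boundary. Testing \<open>\<nabla>\<kappa>\<nabla>g = \<delta>\<^sub>w\<close> with a cutoff that equals 1 except in
  an \<open>\<epsilon>\<close>-collar of the boundary gives \<open>1 = \<integral> g \<nabla>\<kappa>\<nabla>f\<close>, where the integrand is \<open>o(\<epsilon>) O(1/\<epsilon>\<^sup>2)\<close> on a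
  set of area \<open>O(\<epsilon>)\<close>: a contradiction as \<open>\<epsilon> \<rightarrow> 0\<close>.
\<close>

section \<open>Smooth functions and cutoffs\<close>

text \<open>A velocity in the sense of \<open>has_normal_velocity\<close> comes with its own
  \<open>r\<close> and \<open>\<delta>\<close> at every boundary point. Nothing is uniform along the
  boundary, so the area cannot simply be differentiated under an integral. Two facts make up for
  this: \<open>V\<close> is continuous, because \<open>g\<close> is continuously differentiable up
  to the boundary, and it is enough to show that certain sets are null, so a crude covering estimate
  with factor 16 can replace the change of variables formula. For the cutoff, a function of the
  distance to the boundary would require control of two derivatives of that distance. Summing a
  partition of unity over the grid squares inside \<open>D\<close> gives the bound
  \<open>O(1/\<epsilon>\<^sup>2)\<close> for any bounded open set, and the shape of the boundary
  enters only through the area of its collar, for which Lipschitz arcs suffice. The orders balance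
  exactly, \<open>\<epsilon> * (1/\<epsilon>\<^sup>2) * \<epsilon> = 1\<close>, as they must when
  the gradient of \<open>g\<close> does not vanish; the contradiction comes only from the factor
  gained when \<open>g\<close> is \<open>o(dist)\<close> instead of \<open>O(dist)\<close>.\<close>

fun times_differentiable :: "nat \<Rightarrow> (real \<Rightarrow> real) \<Rightarrow> bool" where
  "times_differentiable 0 f = True"
| "times_differentiable (Suc n) f =
     (\<exists>f'. (\<forall>x. (f has_real_derivative f' x) (at x)) \<and> times_differentiable n f')"

lemma times_differentiable_SucI:
  "(\<And>x. (f has_real_derivative f' x) (at x)) \<Longrightarrow> times_differentiable n f' \<Longrightarrow>
     times_differentiable (Suc n) f"
  by auto

lemma times_differentiable_Suc_D: "times_differentiable (Suc n) f \<Longrightarrow> times_differentiable n f"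
proof (induction n arbitrary: f)
  case (Suc n)
  then obtain f' where "\<forall>x. (f has_real_derivative f' x) (at x)" "times_differentiable (Suc n) f'"
    by auto
  with Suc.IH show ?case by auto
qed simp

lemma times_differentiable_add:
  "times_differentiable n f \<Longrightarrow> times_differentiable n g \<Longrightarrow> times_differentiable n (\<lambda>x. f x + g x)"
proof (induction n arbitrary: f g)
  case (Suc n)
  then obtain f' g' where f: "\<forall>x. (f has_real_derivative f' x) (at x)" "times_differentiable n f'"
    and g: "\<forall>x. (g has_real_derivative g' x) (at x)" "times_differentiable n g'" by auto
  have "\<forall>x. ((\<lambda>x. f x + g x) has_real_derivative f' x + g' x) (at x)"
    using f g by (auto intro!: derivative_intros)
  moreover have "times_differentiable n (\<lambda>x. f' x + g' x)"
    using Suc.IH[OF f(2) g(2)] .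
  ultimately show ?case by (intro times_differentiable_SucI[where f' = "\<lambda>x. f' x + g' x"]) (erule spec)
qed simp

lemma times_differentiable_mult:
  "times_differentiable n f \<Longrightarrow> times_differentiable n g \<Longrightarrow> times_differentiable n (\<lambda>x. f x * g x)"
proof (induction n arbitrary: f g)
  case (Suc n)
  then obtain f' g' where f: "\<forall>x. (f has_real_derivative f' x) (at x)" "times_differentiable n f'"
    and g: "\<forall>x. (g has_real_derivative g' x) (at x)" "times_differentiable n g'" by auto
  have "\<forall>x. ((\<lambda>x. f x * g x) has_real_derivative f' x * g x + f x * g' x) (at x)"
    using f g by (auto intro!: derivative_eq_intros)
  moreover have "times_differentiable n (\<lambda>x. f' x * g x + f x * g' x)"
    \<comment> \<open>The derivative of the product still contains \<open>f\<close> and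
      \<open>g\<close>, so they are needed at order \<open>n\<close> as well.\<close>
    using Suc.prems[THEN times_differentiable_Suc_D] f(2) g(2)
    by (intro times_differentiable_add Suc.IH)
  ultimately show ?case by (intro times_differentiable_SucI[where f' = "\<lambda>x. f' x * g x + f x * g' x"]) (erule spec)
qed simp

lemma times_differentiable_const: "times_differentiable n (\<lambda>x. c)"
proof (induction n arbitrary: c)
  case (Suc n) then show ?case by (auto intro!: exI[of _ "\<lambda>x. 0"])
qed simp

lemma times_differentiable_affine:
  "times_differentiable n f \<Longrightarrow> times_differentiable n (\<lambda>x. f (a * x + b))"
proof (induction n arbitrary: f)
  case (Suc n)
  then obtain f' where f: "\<And>x. (f has_real_derivative f' x) (at x)" "times_differentiable n f'" by auto
  have "\<forall>x. ((\<lambda>x. f (a * x + b)) has_real_derivative f' (a * x + b) * a) (at x)"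
  proof
    fix x show "((\<lambda>x. f (a * x + b)) has_real_derivative f' (a * x + b) * a) (at x)"
      by (rule DERIV_chain2[OF f(1)]) (auto intro!: derivative_eq_intros)
  qed
  moreover have "times_differentiable n (\<lambda>x. f' (a * x + b) * a)"
    by (rule times_differentiable_mult[OF Suc.IH[OF f(2)] times_differentiable_const])
  ultimately show ?case by (intro times_differentiable_SucI[where f' = "\<lambda>x. f' (a * x + b) * a"]) (erule spec)
qed simp

lemma times_differentiable_inverse:
  "times_differentiable n f \<Longrightarrow> (\<And>x. f x \<noteq> 0) \<Longrightarrow> times_differentiable n (\<lambda>x. inverse (f x))"
proof (induction n arbitrary: f)
  case (Suc n)
  then obtain f' where f: "\<forall>x. (f has_real_derivative f' x) (at x)" "times_differentiable n f'" by auto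
  have "\<forall>x. ((\<lambda>x. inverse (f x)) has_real_derivative - (inverse (f x) * f' x * inverse (f x))) (at x)"
    using f Suc.prems by (auto intro!: derivative_eq_intros)
  hence "\<forall>x. ((\<lambda>x. inverse (f x)) has_real_derivative - 1 * (inverse (f x) * f' x * inverse (f x))) (at x)"
    by simp
  moreover have "times_differentiable n (\<lambda>x. - 1 * (inverse (f x) * f' x * inverse (f x)))"
    using Suc.prems(1)[THEN times_differentiable_Suc_D] Suc.prems(2) f(2)
    by (intro times_differentiable_mult Suc.IH times_differentiable_const)
  ultimately show ?case
    by (intro times_differentiable_SucI[where f' = "\<lambda>x. - 1 * (inverse (f x) * f' x * inverse (f x))"]) (erule spec)
qed simp

text \<open>These functions, the products of \<open>exp (-1/x)\<close> with a polynomial in \<open>1/x\<close>, are closed under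
  differentiation.\<close>

definition flat :: "real poly \<Rightarrow> real \<Rightarrow> real" where
  "flat p x = (if x > 0 then poly p (1 / x) * exp (- (1 / x)) else 0)"

text \<open>Read with \<open>y = 1 / x\<close>, this controls \<open>flat p\<close> and its
  difference quotients as \<open>x\<close> decreases to 0.\<close>

lemma poly_over_exp_tendsto_0: "((\<lambda>y::real. poly p y * exp (- y)) \<longlongrightarrow> 0) at_top"
proof -
  have "((\<lambda>y::real. \<Sum>i\<le>degree p. coeff p i * (y ^ i / exp y)) \<longlongrightarrow> (\<Sum>i\<le>degree p. coeff p i * 0)) at_top"
    by (intro tendsto_sum tendsto_mult tendsto_const tendsto_power_div_exp_0)
  thus ?thesis
    unfolding poly_altdef by (simp add: exp_minus divide_inverse sum_distrib_right mult.assoc)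
qed

text \<open>With \<open>y = 1 / x\<close>, differentiation in \<open>x\<close> is
  \<open>- y\<^sup>2\<close> times differentiation in \<open>y\<close>, and
  \<open>p(y) e^(-y)\<close> has \<open>y\<close>-derivative \<open>(p' - p)(y) e^(-y)\<close>;
  hence the polynomial \<open>y\<^sup>2 (p - p')\<close>. At 0 the quotient
  \<open>flat p h / h\<close> equals \<open>y p(y) e^(-y)\<close>, which is where
  \<open>pCons 0 p\<close> comes from.\<close>

lemma flat_deriv: "(flat p has_real_derivative flat ([:0, 0, 1:] * (p - pderiv p)) x) (at x)"
proof (cases "x = 0")
  case True
  have right: "((\<lambda>h. flat p h / h) \<longlongrightarrow> 0) (at_right 0)"
  proof -
    have "((\<lambda>h. poly (pCons 0 p) (inverse h) * exp (- inverse h)) \<longlongrightarrow> 0) (at_right (0::real))"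
      using filterlim_compose[OF poly_over_exp_tendsto_0 filterlim_inverse_at_top_right] .
    moreover have "\<forall>\<^sub>F h in at_right 0. poly (pCons 0 p) (inverse h) * exp (- inverse h) = flat p h / h"
      using eventually_at_right_less[of "0::real"]
      by eventually_elim (simp add: flat_def field_simps)
    ultimately show ?thesis by (rule Lim_transform_eventually)
  qed
  have left: "((\<lambda>h. flat p h / h) \<longlongrightarrow> 0) (at_left 0)"
  proof (rule Lim_transform_eventually[OF tendsto_const])
    show "\<forall>\<^sub>F h in at_left 0. 0 = flat p h / h"
      by (auto simp: eventually_at_left_field flat_def intro!: exI[of _ "-1"])
  qed
  have "((\<lambda>h. flat p h / h) \<longlongrightarrow> 0) (at 0)"
    using left right by (simp add: filterlim_split_at)
  moreover have "flat p 0 = 0" "flat ([:0, 0, 1:] * (p - pderiv p)) 0 = 0" by (auto simp: flat_def)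
  ultimately show ?thesis using True by (simp add: has_field_derivative_iff)
next
  case False
  show ?thesis
  proof (cases "x > 0")
    case True
    have "((\<lambda>x. poly p (1 / x) * exp (- (1 / x))) has_real_derivative
        flat ([:0, 0, 1:] * (p - pderiv p)) x) (at x)"
    proof -
      have inv: "((\<lambda>x. 1 / x) has_real_derivative - (1 / x\<^sup>2)) (at x)"
        using True by (auto intro!: derivative_eq_intros simp: power2_eq_square)
      have "((\<lambda>x. poly p (1 / x)) has_real_derivative poly (pderiv p) (1 / x) * - (1 / x\<^sup>2)) (at x)"
        by (rule DERIV_chain2[OF poly_DERIV inv])
      moreover have "((\<lambda>x. exp (- (1 / x))) has_real_derivative exp (- (1 / x)) * (1 / x\<^sup>2)) (at x)"
        using DERIV_chain2[OF DERIV_exp DERIV_minus[OF inv]] by simp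
      ultimately have "((\<lambda>x. poly p (1 / x) * exp (- (1 / x))) has_real_derivative
        poly (pderiv p) (1 / x) * - (1 / x\<^sup>2) * exp (- (1 / x)) + exp (- (1 / x)) * (1 / x\<^sup>2) * poly p (1 / x)) (at x)"
        by (rule DERIV_mult)
      moreover have "poly (pderiv p) (1 / x) * - (1 / x\<^sup>2) * exp (- (1 / x)) + exp (- (1 / x)) * (1 / x\<^sup>2) * poly p (1 / x)
         = flat ([:0, 0, 1:] * (p - pderiv p)) x"
        using True by (simp add: flat_def power2_eq_square algebra_simps)
      ultimately show ?thesis by simp
    qed
    then show ?thesis
      by (rule has_field_derivative_transform_within_open[where S="{0<..}"])
         (use True in \<open>auto simp: flat_def\<close>)
  next
    case nonpos: False
    have "((\<lambda>x. 0) has_real_derivative flat ([:0, 0, 1:] * (p - pderiv p)) x) (at x)"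
      using nonpos False by (auto simp: flat_def)
    then show ?thesis
      by (rule has_field_derivative_transform_within_open[where S="{..<0}"])
         (use nonpos False in \<open>auto simp: flat_def\<close>)
  qed
qed

lemma times_differentiable_flat: "times_differentiable n (flat p)"
proof (induction n arbitrary: p)
  case (Suc n) then show ?case using flat_deriv by auto
qed simp

text \<open>The witness is \<open>h x / (h x + h (1 - x))\<close> with \<open>h = flat 1\<close>.
  Its denominator is positive because \<open>x\<close> and \<open>1 - x\<close> cannot both be
  nonpositive. The reflection is written \<open>(-1) * x + 1\<close> to fit
  \<open>times_differentiable_affine\<close>.\<close>

lemma smooth_step_exists:
  obtains s where "\<And>n. times_differentiable n s" "\<And>x. x \<le> 0 \<Longrightarrow> s x = 0" "\<And>x. x \<ge> 1 \<Longrightarrow> s x = 1"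
proof
  let ?h = "flat 1"
  let ?s = "\<lambda>x. ?h x * inverse (?h x + ?h ((-1) * x + 1))"
  have pos: "?h x > 0" if "x > 0" for x using that by (simp add: flat_def)
  have zero: "?h x = 0" if "x \<le> 0" for x using that by (simp add: flat_def)
  have "?h x + ?h ((-1) * x + 1) > 0" for x
  proof (cases "x > 0")
    case True
    then show ?thesis using pos[of x] pos[of "(-1) * x + 1"] zero[of "(-1) * x + 1"] by linarith
  next
    case False
    then show ?thesis using pos[of "(-1) * x + 1"] zero[of x] by linarith
  qed
  then have "?h x + ?h ((-1) * x + 1) \<noteq> 0" for x
    by (metis less_irrefl)
  with times_differentiable_add[OF times_differentiable_flat
      times_differentiable_affine[OF times_differentiable_flat]]
  have "times_differentiable n (\<lambda>x. inverse (?h x + ?h ((-1) * x + 1)))" for n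
    by (rule times_differentiable_inverse)
  then show "times_differentiable n ?s" for n
    by (rule times_differentiable_mult[OF times_differentiable_flat])
  show "?s x = 0" if "x \<le> 0" for x using zero[OF that] by simp
  show "?s x = 1" if "x \<ge> 1" for x
    using pos[of x] zero[of "(-1) * x + 1"] that by simp
qed

text \<open>The difference \<open>s (x + 1) - s x\<close> of two shifts of a step has support in
  \<open>[-1, 1]\<close>, and its integer translates telescope, so they sum to 1 without any
  normalisation.\<close>

lemma smooth_partition_bump_exists:
  obtains \<beta> \<beta>1 \<beta>2 :: "real \<Rightarrow> real" and B :: real
  where "\<And>n. times_differentiable n \<beta>"
    "\<And>x. (\<beta> has_real_derivative \<beta>1 x) (at x)" "\<And>x. (\<beta>1 has_real_derivative \<beta>2 x) (at x)"
    "\<And>x. \<bar>x\<bar> > 1 \<Longrightarrow> \<beta> x = 0" "\<And>x. \<bar>x\<bar> > 1 \<Longrightarrow> \<beta>1 x = 0" "\<And>x. \<bar>x\<bar> > 1 \<Longrightarrow> \<beta>2 x = 0"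
    "\<And>x. \<bar>\<beta> x\<bar> \<le> B" "\<And>x. \<bar>\<beta>1 x\<bar> \<le> B" "\<And>x. \<bar>\<beta>2 x\<bar> \<le> B"
    "\<And>x a b. of_int a \<le> x \<Longrightarrow> x \<le> of_int b \<Longrightarrow> (\<Sum>i\<in>{a..b}. \<beta> (x - of_int i)) = 1"
proof -
  obtain s where s: "\<And>n. times_differentiable n s" "\<And>x. x \<le> 0 \<Longrightarrow> s x = 0" "\<And>x. x \<ge> 1 \<Longrightarrow> s x = 1"
    by (rule smooth_step_exists) blast
  define \<beta> where "\<beta> x = s (1 * x + 1) + (-1) * s x" for x
  have smooth: "times_differentiable n \<beta>" for n
    unfolding \<beta>_def
    by (rule times_differentiable_add[OF times_differentiable_affine[OF s(1)]
          times_differentiable_mult[OF times_differentiable_const s(1)]])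
  \<comment> \<open>The third derivative serves only to make \<open>\<beta>2\<close> continuous,
    hence bounded on \<open>[-1, 1]\<close>.\<close>
  have "times_differentiable (Suc (Suc (Suc 0))) \<beta>" by (rule smooth)
  then obtain \<beta>1 \<beta>2 \<beta>3 where d: "\<And>x. (\<beta> has_real_derivative \<beta>1 x) (at x)"
    "\<And>x. (\<beta>1 has_real_derivative \<beta>2 x) (at x)" "\<And>x. (\<beta>2 has_real_derivative \<beta>3 x) (at x)"
    by auto
  have zero: "f' x = 0"
    if f: "\<And>x. (f has_real_derivative f' x) (at x)" "\<And>x. \<bar>x\<bar> > 1 \<Longrightarrow> f x = 0" and x: "\<bar>x\<bar> > 1"
    for f f' :: "real \<Rightarrow> real" and x
  proof -
    have op: "open {x::real. \<bar>x\<bar> > 1}" by (intro open_Collect_less continuous_intros)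
    have "(f has_real_derivative 0) (at x)"
      by (rule has_field_derivative_transform_within_open[OF _ op, of "\<lambda>x. 0"]) (use f(2) x in auto)
    then show ?thesis using f(1) DERIV_unique by blast
  qed
  have z0: "\<beta> x = 0" if "\<bar>x\<bar> > 1" for x
    using that s(2)[of x] s(2)[of "x + 1"] s(3)[of x] s(3)[of "x + 1"] by (simp add: \<beta>_def) linarith
  have z1: "\<beta>1 x = 0" if "\<bar>x\<bar> > 1" for x using zero[OF d(1) z0 that] .
  have z2: "\<beta>2 x = 0" if "\<bar>x\<bar> > 1" for x using zero[OF d(2) z1 that] .
  have bnd: "\<exists>B. \<forall>x. \<bar>f x\<bar> \<le> B"
    if f: "\<And>x. (f has_real_derivative f' x) (at x)" "\<And>x. \<bar>x\<bar> > 1 \<Longrightarrow> f x = 0"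
    for f f' :: "real \<Rightarrow> real"
  proof -
    have "continuous_on {-1..1} f"
      using f(1) by (meson DERIV_atLeastAtMost_imp_continuous_on)
    then have "bounded (f ` {-1..1})"
      using compact_continuous_image compact_imp_bounded by blast
    then obtain B where "B > 0" and B: "\<forall>y \<in> f ` {-1..1}. norm y \<le> B"
      unfolding bounded_pos by blast
    have "\<bar>f x\<bar> \<le> B" for x
    proof (cases "\<bar>x\<bar> > 1")
      case False
      then have "x \<in> {-1..1}" by auto
      then show ?thesis using B by auto
    next
      case True
      then show ?thesis using f(2)[OF True] \<open>B > 0\<close> by simp
    qed
    then show ?thesis by blast
  qed
  obtain B0 B1 B2 where B: "\<And>x. \<bar>\<beta> x\<bar> \<le> B0" "\<And>x. \<bar>\<beta>1 x\<bar> \<le> B1" "\<And>x. \<bar>\<beta>2 x\<bar> \<le> B2"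
    using bnd[OF d(1) z0] bnd[OF d(2) z1] bnd[OF d(3) z2] by metis
  have tele: "a \<le> b \<Longrightarrow> (\<Sum>i\<in>{a..b}. \<beta> (x - of_int i)) = s (x - of_int a + 1) - s (x - of_int b)"
    for x :: real and a b :: int
  proof (induction b rule: int_ge_induct)
    case (step b)
    have "{a..b + 1} = insert (b + 1) {a..b}" using step by auto
    then show ?case using step by (simp add: \<beta>_def)
  qed (simp add: \<beta>_def)
  have one: "(\<Sum>i\<in>{a..b}. \<beta> (x - of_int i)) = 1" if "of_int a \<le> x" "x \<le> of_int b" for x a b
  proof -
    have "real_of_int a \<le> real_of_int b" using that by linarith
    then show ?thesis using tele[of a b x] s(2,3) that by simp
  qed
  show ?thesis
    by (rule that[of \<beta> \<beta>1 \<beta>2 "max B0 (max B1 B2)"])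
       (use smooth d z0 z1 z2 B one in \<open>auto simp: le_max_iff_disj\<close>)
qed

section \<open>Iterated directional derivatives in the plane\<close>

lemma dir_deriv_eq:
  "(f has_derivative f') (at z) \<Longrightarrow> dir_deriv v f z = f' v"
  unfolding dir_deriv_def using frechet_derivative_at by metis

text \<open>A finite-order stage of \<open>smooth_on UNIV\<close>, with all directions allowed at
  every level. Counting orders instead of listing directions lets sums and products be handled by
  induction on the order.\<close>

fun times_dir_differentiable :: "nat \<Rightarrow> (complex \<Rightarrow> real) \<Rightarrow> bool" where
  "times_dir_differentiable 0 f = True"
| "times_dir_differentiable (Suc n) f =
     ((\<forall>z. f differentiable (at z)) \<and> (\<forall>v. times_dir_differentiable n (dir_deriv v f)))"

lemma times_dir_differentiable_SucI:
  "(\<And>z. (f has_derivative f' z) (at z)) \<Longrightarrow> (\<And>v. times_dir_differentiable n (\<lambda>z. f' z v)) \<Longrightarrow>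
     times_dir_differentiable (Suc n) f"
proof -
  assume f: "\<And>z. (f has_derivative f' z) (at z)" and n: "\<And>v. times_dir_differentiable n (\<lambda>z. f' z v)"
  have "dir_deriv v f = (\<lambda>z. f' z v)" for v using dir_deriv_eq[OF f] by auto
  with f n show ?thesis by (auto simp: differentiable_def)
qed

lemma times_dir_differentiable_Suc_E:
  assumes "times_dir_differentiable (Suc n) f"
  obtains f' where "\<And>z. (f has_derivative f' z) (at z)" "\<And>v. times_dir_differentiable n (\<lambda>z. f' z v)"
proof -
  have "(f has_derivative (\<lambda>v. dir_deriv v f z)) (at z)" for z
    using assms frechet_derivative_works unfolding dir_deriv_def by auto
  with assms that[of "\<lambda>z v. dir_deriv v f z"] show ?thesis by simp
qed

lemma times_dir_differentiable_Suc_D: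
  "times_dir_differentiable (Suc n) f \<Longrightarrow> times_dir_differentiable n f"
  by (induction n arbitrary: f) auto

lemma times_dir_differentiable_const: "times_dir_differentiable n (\<lambda>z. c)"
proof (induction n arbitrary: c)
  case (Suc n)
  show ?case by (rule times_dir_differentiable_SucI[where f' = "\<lambda>z v. 0"]) (auto intro: Suc)
qed simp

lemma times_dir_differentiable_add:
  "times_dir_differentiable n f \<Longrightarrow> times_dir_differentiable n g \<Longrightarrow>
     times_dir_differentiable n (\<lambda>z. f z + g z)"
proof (induction n arbitrary: f g)
  case (Suc n)
  obtain f' where f: "\<And>z. (f has_derivative f' z) (at z)" "\<And>v. times_dir_differentiable n (\<lambda>z. f' z v)"
    using Suc.prems(1) by (rule times_dir_differentiable_Suc_E) blast
  obtain g' where g: "\<And>z. (g has_derivative g' z) (at z)" "\<And>v. times_dir_differentiable n (\<lambda>z. g' z v)"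
    using Suc.prems(2) by (rule times_dir_differentiable_Suc_E) blast
  show ?case
    by (rule times_dir_differentiable_SucI[where f' = "\<lambda>z v. f' z v + g' z v"])
       (rule has_derivative_add[OF f(1) g(1)], rule Suc.IH[OF f(2) g(2)])
qed simp

lemma times_dir_differentiable_mult:
  "times_dir_differentiable n f \<Longrightarrow> times_dir_differentiable n g \<Longrightarrow>
     times_dir_differentiable n (\<lambda>z. f z * g z)"
proof (induction n arbitrary: f g)
  case (Suc n)
  obtain f' where f: "\<And>z. (f has_derivative f' z) (at z)" "\<And>v. times_dir_differentiable n (\<lambda>z. f' z v)"
    using Suc.prems(1) by (rule times_dir_differentiable_Suc_E) blast
  obtain g' where g: "\<And>z. (g has_derivative g' z) (at z)" "\<And>v. times_dir_differentiable n (\<lambda>z. g' z v)"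
    using Suc.prems(2) by (rule times_dir_differentiable_Suc_E) blast
  note D = Suc.prems[THEN times_dir_differentiable_Suc_D]
  show ?case
    by (rule times_dir_differentiable_SucI[where f' = "\<lambda>z v. f z * g' z v + f' z v * g z"])
       (rule has_derivative_mult[OF f(1) g(1)],
        rule times_dir_differentiable_add[OF Suc.IH[OF D(1) g(2)] Suc.IH[OF f(2) D(2)]])
qed simp

lemma times_dir_differentiable_sum:
  assumes "\<And>i. i \<in> I \<Longrightarrow> times_dir_differentiable n (f i)"
  shows "times_dir_differentiable n (\<lambda>z. \<Sum>i\<in>I. f i z)"
  using assms
proof (induction I rule: infinite_finite_induct)
  case (insert i I)
  then show ?case by (simp add: times_dir_differentiable_add)
qed (simp_all add: times_dir_differentiable_const)

lemma times_dir_differentiable_compose_linear: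
  assumes "bounded_linear L"
  shows "times_differentiable n \<phi> \<Longrightarrow> times_dir_differentiable n (\<lambda>z. \<phi> (L z))"
proof (induction n arbitrary: \<phi>)
  case (Suc n)
  then obtain \<phi>' where \<phi>: "\<And>x. (\<phi> has_real_derivative \<phi>' x) (at x)" "times_differentiable n \<phi>'" by auto
  show ?case
  proof (rule times_dir_differentiable_SucI[where f' = "\<lambda>z v. \<phi>' (L z) * L v"])
    show "((\<lambda>z. \<phi> (L z)) has_derivative (\<lambda>v. \<phi>' (L z) * L v)) (at z)" for z
      using has_derivative_compose[OF bounded_linear_imp_has_derivative[OF assms]
          \<phi>(1)[THEN has_field_derivative_imp_has_derivative]] .
    show "times_dir_differentiable n (\<lambda>z. \<phi>' (L z) * L v)" for v
      by (rule times_dir_differentiable_mult[OF Suc.IH[OF \<phi>(2)] times_dir_differentiable_const])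
  qed
qed simp

text \<open>Every direction in the list uses up one order, so the induction over the list has to
  carry all orders at once.\<close>

lemma smooth_on_UNIV_I:
  assumes "\<And>n. times_dir_differentiable n f"
  shows "smooth_on UNIV f"
proof -
  have "\<forall>n. times_dir_differentiable n (foldr dir_deriv vs f)" for vs
  proof (induction vs)
    case (Cons v vs)
    show ?case
    proof
      fix n
      from Cons have "times_dir_differentiable (Suc n) (foldr dir_deriv vs f)" by blast
      then show "times_dir_differentiable n (foldr dir_deriv (v # vs) f)" by simp
    qed
  qed (use assms in simp)
  then have "times_dir_differentiable (Suc 0) (foldr dir_deriv vs f)" for vs by blast
  then show ?thesis
    by (auto simp: smooth_on_def differentiable_on_def)
qed

text \<open>The two profiles are kept separate so that a partial derivative of a grid sum is again a
  grid sum: one profile is replaced by its derivative, with a factor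
  \<open>1 / \<epsilon>\<close>.\<close>

definition grid_sum ::
  "real \<Rightarrow> (int \<times> int) set \<Rightarrow> (real \<Rightarrow> real) \<Rightarrow> (real \<Rightarrow> real) \<Rightarrow> complex \<Rightarrow> real" where
  "grid_sum \<epsilon> M \<alpha> \<gamma> z = (\<Sum>m\<in>M. \<alpha> (Re z / \<epsilon> - of_int (fst m)) * \<gamma> (Im z / \<epsilon> - of_int (snd m)))"

lemma grid_sum_has_derivative:
  assumes "\<And>x. (\<alpha> has_real_derivative \<alpha>' x) (at x)" "\<And>x. (\<gamma> has_real_derivative \<gamma>' x) (at x)"
  shows "(grid_sum \<epsilon> M \<alpha> \<gamma> has_derivative
    (\<lambda>h. (1 / \<epsilon>) * grid_sum \<epsilon> M \<alpha>' \<gamma> z * Re h + (1 / \<epsilon>) * grid_sum \<epsilon> M \<alpha> \<gamma>' z * Im h)) (at z)"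
proof -
  have R: "((\<lambda>z. \<alpha> (Re z / \<epsilon> - c)) has_derivative (\<lambda>h. \<alpha>' (Re z / \<epsilon> - c) * (Re h / \<epsilon>))) (at z)" for c
    by (rule has_derivative_compose[OF _ assms(1)[THEN has_field_derivative_imp_has_derivative]])
       (auto intro!: derivative_eq_intros simp: divide_inverse)
  have I: "((\<lambda>z. \<gamma> (Im z / \<epsilon> - c)) has_derivative (\<lambda>h. \<gamma>' (Im z / \<epsilon> - c) * (Im h / \<epsilon>))) (at z)" for c
    by (rule has_derivative_compose[OF _ assms(2)[THEN has_field_derivative_imp_has_derivative]])
       (auto intro!: derivative_eq_intros simp: divide_inverse)
  have "((\<lambda>z. \<Sum>m\<in>M. \<alpha> (Re z / \<epsilon> - of_int (fst m)) * \<gamma> (Im z / \<epsilon> - of_int (snd m))) has_derivative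
     (\<lambda>h. \<Sum>m\<in>M. \<alpha> (Re z / \<epsilon> - of_int (fst m)) * (\<gamma>' (Im z / \<epsilon> - of_int (snd m)) * (Im h / \<epsilon>)) +
       \<alpha>' (Re z / \<epsilon> - of_int (fst m)) * (Re h / \<epsilon>) * \<gamma> (Im z / \<epsilon> - of_int (snd m)))) (at z)"
    by (intro has_derivative_sum has_derivative_mult[OF R I])
  moreover have "(\<lambda>h. \<Sum>m\<in>M. \<alpha> (Re z / \<epsilon> - of_int (fst m)) * (\<gamma>' (Im z / \<epsilon> - of_int (snd m)) * (Im h / \<epsilon>)) +
       \<alpha>' (Re z / \<epsilon> - of_int (fst m)) * (Re h / \<epsilon>) * \<gamma> (Im z / \<epsilon> - of_int (snd m)))
    = (\<lambda>h. (1 / \<epsilon>) * grid_sum \<epsilon> M \<alpha>' \<gamma> z * Re h + (1 / \<epsilon>) * grid_sum \<epsilon> M \<alpha> \<gamma>' z * Im h)"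
    unfolding grid_sum_def sum_distrib_left sum_distrib_right sum.distrib[symmetric]
    by (intro ext sum.cong refl) (simp add: algebra_simps)
  ultimately show ?thesis unfolding grid_sum_def[abs_def] by simp
qed

text \<open>At any point at most nine indices contribute, three per coordinate, so the bound depends
  neither on the mesh nor on the number of indices.\<close>

lemma grid_sum_bound:
  assumes fin: "finite M" and "\<And>x. \<bar>x\<bar> > 1 \<Longrightarrow> \<alpha> x = 0" "\<And>x. \<bar>x\<bar> > 1 \<Longrightarrow> \<gamma> x = 0"
    and "\<And>x. \<bar>\<alpha> x\<bar> \<le> B" "\<And>x. \<bar>\<gamma> x\<bar> \<le> B"
  shows "\<bar>grid_sum \<epsilon> M \<alpha> \<gamma> z\<bar> \<le> 9 * B\<^sup>2"
proof -
  define X Y where "X = Re z / \<epsilon>" and "Y = Im z / \<epsilon>"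
  define N where "N = {\<lfloor>X\<rfloor> - 1..\<lfloor>X\<rfloor> + 1} \<times> {\<lfloor>Y\<rfloor> - 1..\<lfloor>Y\<rfloor> + 1}"
  define a where "a m = \<alpha> (X - of_int (fst m)) * \<gamma> (Y - of_int (snd m))" for m :: "int \<times> int"
  have "card N = 9" by (simp add: N_def card_cartesian_product)
  have near: "i \<in> {\<lfloor>x\<rfloor> - 1..\<lfloor>x\<rfloor> + 1}" if "\<bar>x - of_int i\<bar> \<le> 1" for x :: real and i
    using that by (auto simp: abs_le_iff) linarith+
  have out: "a m = 0" if "m \<notin> N" for m
    using that near[of X "fst m"] near[of Y "snd m"] assms(2)[of "X - of_int (fst m)"]
      assms(3)[of "Y - of_int (snd m)"]
    unfolding N_def a_def by (cases m) (simp, linarith)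
  have le: "\<bar>a m\<bar> \<le> B\<^sup>2" for m
    unfolding a_def abs_mult power2_eq_square
    using assms(4,5) by (intro mult_mono) (auto intro: order_trans[OF abs_ge_zero])
  have "grid_sum \<epsilon> M \<alpha> \<gamma> z = sum a M" by (simp add: grid_sum_def a_def X_def Y_def)
  also have "\<dots> = sum a (M \<inter> N)"
    using fin out by (intro sum.mono_neutral_right) auto
  also have "\<bar>\<dots>\<bar> \<le> (\<Sum>m\<in>M \<inter> N. B\<^sup>2)"
    using le by (intro order_trans[OF sum_abs] sum_mono) auto
  also have "\<dots> \<le> 9 * B\<^sup>2"
  proof -
    have "card (M \<inter> N) \<le> 9" using \<open>card N = 9\<close> by (metis card_mono finite_SigmaI finite_atLeastAtMost_int inf_le2 N_def)
    then have "real (card (M \<inter> N)) \<le> 9" by linarith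
    then show ?thesis by (simp add: mult_right_mono)
  qed
  finally show ?thesis .
qed

text \<open>Indices outside \<open>M\<close> or outside the three-by-three block \<open>N\<close>
  around the point contribute 0. The sum may therefore run over all of \<open>N\<close>, where it
  factors into two one-dimensional partitions of unity.\<close>

lemma grid_sum_eq_1:
  assumes fin: "finite M" and "\<And>x. \<bar>x\<bar> > 1 \<Longrightarrow> \<beta> x = 0"
    and one: "\<And>x a b. of_int a \<le> x \<Longrightarrow> x \<le> of_int b \<Longrightarrow> (\<Sum>i\<in>{a..b}. \<beta> (x - of_int i)) = (1::real)"
    and M: "\<And>i j. \<bar>Re z / \<epsilon> - of_int i\<bar> \<le> 1 \<Longrightarrow> \<bar>Im z / \<epsilon> - of_int j\<bar> \<le> 1 \<Longrightarrow> (i, j) \<in> M"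
  shows "grid_sum \<epsilon> M \<beta> \<beta> z = 1"
proof -
  define X Y where "X = Re z / \<epsilon>" and "Y = Im z / \<epsilon>"
  define N where "N = {\<lfloor>X\<rfloor> - 1..\<lfloor>X\<rfloor> + 1} \<times> {\<lfloor>Y\<rfloor> - 1..\<lfloor>Y\<rfloor> + 1}"
  define a where "a m = \<beta> (X - of_int (fst m)) * \<beta> (Y - of_int (snd m))" for m :: "int \<times> int"
  have "finite N" by (simp add: N_def)
  have near: "i \<in> {\<lfloor>x\<rfloor> - 1..\<lfloor>x\<rfloor> + 1}" if "\<bar>x - of_int i\<bar> \<le> 1" for x :: real and i
    using that by (auto simp: abs_le_iff) linarith+
  have out: "a m = 0" if "m \<notin> N" for m
    using that near[of X "fst m"] near[of Y "snd m"] assms(2)[of "X - of_int (fst m)"]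
      assms(2)[of "Y - of_int (snd m)"]
    unfolding N_def a_def by (cases m) (simp, linarith)
  have outM: "a m = 0" if "m \<notin> M" for m
  proof -
    have "\<bar>X - of_int (fst m)\<bar> > 1 \<or> \<bar>Y - of_int (snd m)\<bar> > 1"
      using that M[of "fst m" "snd m"] unfolding X_def Y_def prod.collapse by linarith
    then show ?thesis using assms(2) unfolding a_def by auto
  qed
  have "grid_sum \<epsilon> M \<beta> \<beta> z = sum a M" by (simp add: grid_sum_def a_def X_def Y_def)
  also have "\<dots> = sum a (M \<inter> N)"
    using fin out by (intro sum.mono_neutral_right) auto
  also have "\<dots> = sum a N"
    using \<open>finite N\<close> outM by (intro sum.mono_neutral_left) auto
  also have "\<dots> = (\<Sum>i\<in>{\<lfloor>X\<rfloor> - 1..\<lfloor>X\<rfloor> + 1}. \<beta> (X - of_int i)) * (\<Sum>j\<in>{\<lfloor>Y\<rfloor> - 1..\<lfloor>Y\<rfloor> + 1}. \<beta> (Y - of_int j))"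
    unfolding N_def a_def sum_product sum.cartesian_product by (simp add: case_prod_beta)
  also have "\<dots> = 1"
  proof -
    have "(\<Sum>i\<in>{\<lfloor>x\<rfloor> - 1..\<lfloor>x\<rfloor> + 1}. \<beta> (x - of_int i)) = 1" for x
    proof (rule one)
      show "real_of_int (\<lfloor>x\<rfloor> - 1) \<le> x" by linarith
      show "x \<le> real_of_int (\<lfloor>x\<rfloor> + 1)" by linarith
    qed
    then show ?thesis by simp
  qed
  finally show ?thesis .
qed

text \<open>The cutoff is the sum of those members of a partition of unity subordinate to the grid of mesh \<open>\<epsilon>\<close>
  whose supports lie in \<open>D\<close>.\<close>

lemma grid_cutoff:
  assumes D: "open D" "bounded D"
    and \<kappa>: "\<And>z. z \<in> D \<Longrightarrow> \<kappa> differentiable (at z)"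
      "\<And>z. z \<in> D \<Longrightarrow> \<bar>\<kappa> z\<bar> \<le> K" "\<And>z. z \<in> D \<Longrightarrow> \<bar>dir_deriv 1 \<kappa> z\<bar> \<le> K"
      "\<And>z. z \<in> D \<Longrightarrow> \<bar>dir_deriv \<i> \<kappa> z\<bar> \<le> K"
  obtains C where "C \<ge> 0" "\<And>\<epsilon>. 0 < \<epsilon> \<Longrightarrow> \<epsilon> \<le> 1 \<Longrightarrow> \<exists>f. test_function D f \<and>
      (\<forall>z\<in>D. \<bar>div_grad \<kappa> f z\<bar> \<le> C / \<epsilon>\<^sup>2) \<and>
      (\<forall>z. ball z (6 * \<epsilon>) \<subseteq> D \<longrightarrow> f z = 1 \<and> div_grad \<kappa> f z = 0)"
proof -
  obtain \<beta> \<beta>1 \<beta>2 :: "real \<Rightarrow> real" and B :: real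
  where \<beta>: "\<And>n. times_differentiable n \<beta>"
    "\<And>x. (\<beta> has_real_derivative \<beta>1 x) (at x)" "\<And>x. (\<beta>1 has_real_derivative \<beta>2 x) (at x)"
    and out: "\<And>x. \<bar>x\<bar> > 1 \<Longrightarrow> \<beta> x = 0" "\<And>x. \<bar>x\<bar> > 1 \<Longrightarrow> \<beta>1 x = 0" "\<And>x. \<bar>x\<bar> > 1 \<Longrightarrow> \<beta>2 x = 0"
    and B: "\<And>x. \<bar>\<beta> x\<bar> \<le> B" "\<And>x. \<bar>\<beta>1 x\<bar> \<le> B" "\<And>x. \<bar>\<beta>2 x\<bar> \<le> B"
    and one: "\<And>x a b. of_int a \<le> x \<Longrightarrow> x \<le> of_int b \<Longrightarrow> (\<Sum>i\<in>{a..b}. \<beta> (x - of_int i)) = 1"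
    by (rule smooth_partition_bump_exists) (rule that)
  \<comment> \<open>The product rule splits \<open>div_grad\<close> into four terms, each at most
    \<open>\<bar>K\<bar> * 9 * B\<^sup>2 / \<epsilon>\<^sup>2\<close>. The absolute value keeps
    \<open>C\<close> nonnegative even if \<open>D\<close> is empty.\<close>
  define C where "C = 36 * B\<^sup>2 * \<bar>K\<bar>"
  obtain R where R: "\<And>z. z \<in> D \<Longrightarrow> norm z \<le> R" using D(2) unfolding bounded_iff by blast
  show ?thesis
  proof (rule that[of C])
    show "C \<ge> 0" by (simp add: C_def)
    fix \<epsilon> :: real assume \<epsilon>: "0 < \<epsilon>" "\<epsilon> \<le> 1"
    define Q where "Q m = cbox (Complex (\<epsilon> * (of_int (fst m) - 1)) (\<epsilon> * (of_int (snd m) - 1)))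
        (Complex (\<epsilon> * (of_int (fst m) + 1)) (\<epsilon> * (of_int (snd m) + 1)))" for m :: "int \<times> int"
    have Q: "z \<in> Q m \<longleftrightarrow> \<bar>Re z / \<epsilon> - of_int (fst m)\<bar> \<le> 1 \<and> \<bar>Im z / \<epsilon> - of_int (snd m)\<bar> \<le> 1" for z m
    proof -
      have "\<epsilon> * (c - 1) \<le> x \<and> x \<le> \<epsilon> * (c + 1) \<longleftrightarrow> \<bar>x / \<epsilon> - c\<bar> \<le> 1" for x c
        using \<epsilon> by (auto simp: abs_le_iff field_simps)
      then show ?thesis
        unfolding Q_def in_cbox_complex_iff by simp
    qed
    define M where "M = {m. Q m \<subseteq> D}"
    have finM: "finite M"
    proof (rule finite_subset)
      show "M \<subseteq> {-\<lceil>R / \<epsilon>\<rceil>..\<lceil>R / \<epsilon>\<rceil>} \<times> {-\<lceil>R / \<epsilon>\<rceil>..\<lceil>R / \<epsilon>\<rceil>}"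
      proof
        fix m assume "m \<in> M"
        let ?c = "Complex (\<epsilon> * of_int (fst m)) (\<epsilon> * of_int (snd m))"
        have "?c \<in> Q m" using \<epsilon> by (simp add: Q)
        then have "norm ?c \<le> R" using \<open>m \<in> M\<close> R by (auto simp: M_def)
        then have "\<bar>\<epsilon> * of_int (fst m)\<bar> \<le> R" "\<bar>\<epsilon> * of_int (snd m)\<bar> \<le> R"
          using abs_Re_le_cmod[of ?c] abs_Im_le_cmod[of ?c] by auto
        then have "\<bar>real_of_int (fst m)\<bar> \<le> R / \<epsilon>" "\<bar>real_of_int (snd m)\<bar> \<le> R / \<epsilon>"
          using \<epsilon> by (auto simp: abs_mult field_simps)
        then have "\<bar>fst m\<bar> \<le> \<lceil>R / \<epsilon>\<rceil>" "\<bar>snd m\<bar> \<le> \<lceil>R / \<epsilon>\<rceil>" by linarith+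
        then show "m \<in> {-\<lceil>R / \<epsilon>\<rceil>..\<lceil>R / \<epsilon>\<rceil>} \<times> {-\<lceil>R / \<epsilon>\<rceil>..\<lceil>R / \<epsilon>\<rceil>}"
          by (cases m) auto
      qed
    qed simp
    define f where "f = grid_sum \<epsilon> M \<beta> \<beta>"
    define f1 where "f1 = (\<lambda>z. (1 / \<epsilon>) * grid_sum \<epsilon> M \<beta>1 \<beta> z)"
    define f2 where "f2 = (\<lambda>z. (1 / \<epsilon>) * grid_sum \<epsilon> M \<beta> \<beta>1 z)"
    have d: "dir_deriv 1 f = f1" "dir_deriv \<i> f = f2"
      using dir_deriv_eq[OF grid_sum_has_derivative[OF \<beta>(2) \<beta>(2)]]
      by (auto simp: f_def f1_def f2_def)
    have dg: "div_grad \<kappa> f z = dir_deriv 1 \<kappa> z * f1 z + \<kappa> z * ((1 / \<epsilon>) * ((1 / \<epsilon>) * grid_sum \<epsilon> M \<beta>2 \<beta> z))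
      + (dir_deriv \<i> \<kappa> z * f2 z + \<kappa> z * ((1 / \<epsilon>) * ((1 / \<epsilon>) * grid_sum \<epsilon> M \<beta> \<beta>2 z)))" if "z \<in> D" for z
    proof -
      have k: "(\<kappa> has_derivative (\<lambda>v. dir_deriv v \<kappa> z)) (at z)"
        using \<kappa>(1)[OF that] frechet_derivative_works unfolding dir_deriv_def by auto
      have f1: "(f1 has_derivative (\<lambda>h. (1 / \<epsilon>) * ((1 / \<epsilon>) * grid_sum \<epsilon> M \<beta>2 \<beta> z * Re h +
          (1 / \<epsilon>) * grid_sum \<epsilon> M \<beta>1 \<beta>1 z * Im h))) (at z)"
        unfolding f1_def by (rule has_derivative_mult_right[OF grid_sum_has_derivative[OF \<beta>(3) \<beta>(2)]])
      have f2: "(f2 has_derivative (\<lambda>h. (1 / \<epsilon>) * ((1 / \<epsilon>) * grid_sum \<epsilon> M \<beta>1 \<beta>1 z * Re h +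
          (1 / \<epsilon>) * grid_sum \<epsilon> M \<beta> \<beta>2 z * Im h))) (at z)"
        unfolding f2_def by (rule has_derivative_mult_right[OF grid_sum_has_derivative[OF \<beta>(2) \<beta>(3)]])
      show ?thesis
        unfolding div_grad_def d dir_deriv_eq[OF has_derivative_mult[OF k f1]]
          dir_deriv_eq[OF has_derivative_mult[OF k f2]] by simp
    qed
    have bound: "\<bar>div_grad \<kappa> f z\<bar> \<le> C / \<epsilon>\<^sup>2" if "z \<in> D" for z
    proof -
      \<comment> \<open>The terms with a derivative of \<open>\<kappa>\<close> are only of size
        \<open>1 / \<epsilon>\<close>; since \<open>\<epsilon> \<le> 1\<close>, they fit under the
        same bound as the second-order terms.\<close>
      have e: "1 / \<epsilon> \<le> 1 / \<epsilon>\<^sup>2" using \<epsilon> by (simp add: field_simps power2_eq_square)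
      have prod: "\<bar>a * (1 / \<epsilon> * b)\<bar> \<le> \<bar>K\<bar> * (9 * B\<^sup>2 / \<epsilon>\<^sup>2)" if "\<bar>a\<bar> \<le> K" "\<bar>b\<bar> \<le> 9 * B\<^sup>2" for a b
      proof -
        have "\<bar>1 / \<epsilon> * b\<bar> \<le> 1 / \<epsilon>\<^sup>2 * (9 * B\<^sup>2)"
          unfolding abs_mult using that \<epsilon> e by (intro mult_mono) auto
        then show ?thesis unfolding abs_mult[of a] using that by (intro mult_mono) auto
      qed
      have prod': "\<bar>a * (1 / \<epsilon> * (1 / \<epsilon> * b))\<bar> \<le> \<bar>K\<bar> * (9 * B\<^sup>2 / \<epsilon>\<^sup>2)" if "\<bar>a\<bar> \<le> K" "\<bar>b\<bar> \<le> 9 * B\<^sup>2" for a b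
      proof -
        have "\<bar>1 / \<epsilon> * (1 / \<epsilon> * b)\<bar> = 1 / \<epsilon>\<^sup>2 * \<bar>b\<bar>"
          using \<epsilon> by (simp add: abs_mult power2_eq_square)
        also have "\<dots> \<le> 1 / \<epsilon>\<^sup>2 * (9 * B\<^sup>2)"
          using that \<epsilon> by (intro mult_left_mono) auto
        finally show ?thesis unfolding abs_mult[of a] using that by (intro mult_mono) auto
      qed
      note b = grid_sum_bound[OF finM out(2) out(1) B(2) B(1), where \<epsilon> = \<epsilon> and z = z]
         grid_sum_bound[OF finM out(1) out(2) B(1) B(2), where \<epsilon> = \<epsilon> and z = z]
         grid_sum_bound[OF finM out(3) out(1) B(3) B(1), where \<epsilon> = \<epsilon> and z = z]
         grid_sum_bound[OF finM out(1) out(3) B(1) B(3), where \<epsilon> = \<epsilon> and z = z]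
      have "\<bar>div_grad \<kappa> f z\<bar> \<le> \<bar>K\<bar> * (9 * B\<^sup>2 / \<epsilon>\<^sup>2) + \<bar>K\<bar> * (9 * B\<^sup>2 / \<epsilon>\<^sup>2) + (\<bar>K\<bar> * (9 * B\<^sup>2 / \<epsilon>\<^sup>2) + \<bar>K\<bar> * (9 * B\<^sup>2 / \<epsilon>\<^sup>2))"
        unfolding dg[OF that] f1_def f2_def
        by (intro order_trans[OF abs_triangle_ineq] add_mono prod prod' b \<kappa> that)
      also have "\<dots> = C / \<epsilon>\<^sup>2" by (simp add: C_def)
      finally show ?thesis .
    qed
    \<comment> \<open>Two points of one square differ by at most \<open>2 * \<epsilon>\<close> in
      each coordinate, hence by at most \<open>4 * \<epsilon>\<close>; radius 5 leaves room for the
      closed ball. The final radius 6 adds a neighbourhood of radius \<open>\<epsilon>\<close> on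
      which \<open>f\<close> is constant, so that its derivatives vanish too.\<close>
    have f_one: "f z = 1" if z: "ball z (5 * \<epsilon>) \<subseteq> D" for z
      unfolding f_def
    proof (rule grid_sum_eq_1[OF finM out(1) one])
      fix i j :: int
      assume ij: "\<bar>Re z / \<epsilon> - of_int i\<bar> \<le> 1" "\<bar>Im z / \<epsilon> - of_int j\<bar> \<le> 1"
      have "Q (i, j) \<subseteq> cball z (4 * \<epsilon>)"
      proof
        fix u assume "u \<in> Q (i, j)"
        then have u: "\<bar>Re u / \<epsilon> - of_int i\<bar> \<le> 1" "\<bar>Im u / \<epsilon> - of_int j\<bar> \<le> 1" by (auto simp: Q)
        have "\<bar>Re z / \<epsilon> - Re u / \<epsilon>\<bar> \<le> 2" "\<bar>Im z / \<epsilon> - Im u / \<epsilon>\<bar> \<le> 2" using u ij by linarith+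
        then have "\<bar>Re (z - u)\<bar> \<le> 2 * \<epsilon>" "\<bar>Im (z - u)\<bar> \<le> 2 * \<epsilon>"
          using \<epsilon> by (auto simp: abs_le_iff field_simps)
        then have "norm (z - u) \<le> 2 * \<epsilon> + 2 * \<epsilon>" using cmod_le[of "z - u"] by linarith
        then show "u \<in> cball z (4 * \<epsilon>)" using \<epsilon> by (simp add: dist_norm)
      qed
      also have "\<dots> \<subseteq> ball z (5 * \<epsilon>)" using \<epsilon> by (auto simp: subset_iff)
      finally show "(i, j) \<in> M" using z by (auto simp: M_def)
    qed
    have "test_function D f"
      unfolding test_function_def
    proof (intro conjI exI)
      have "times_dir_differentiable n f" for n
      proof -
        have td: "times_differentiable n (\<lambda>x. \<beta> (x / \<epsilon> - c))" for c
          using times_differentiable_affine[OF \<beta>(1), of n "1 / \<epsilon>" "- c"] by simp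
        show ?thesis
          unfolding f_def grid_sum_def[abs_def]
          by (intro times_dir_differentiable_sum times_dir_differentiable_mult
             times_dir_differentiable_compose_linear[OF bounded_linear_Re td]
             times_dir_differentiable_compose_linear[OF bounded_linear_Im td])
      qed
      then show "smooth_on UNIV f" by (rule smooth_on_UNIV_I)
      show "compact (\<Union>m\<in>M. Q m)" using finM by (auto simp: Q_def)
      show "(\<Union>m\<in>M. Q m) \<subseteq> D" by (auto simp: M_def)
      show "\<forall>z. z \<notin> (\<Union>m\<in>M. Q m) \<longrightarrow> f z = 0"
      proof (intro allI impI)
        fix z assume z: "z \<notin> (\<Union>m\<in>M. Q m)"
        have "\<beta> (Re z / \<epsilon> - of_int (fst m)) * \<beta> (Im z / \<epsilon> - of_int (snd m)) = 0" if "m \<in> M" for m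
          using z that out(1)[of "Re z / \<epsilon> - of_int (fst m)"] out(1)[of "Im z / \<epsilon> - of_int (snd m)"]
          by (auto simp: Q not_le)
        then show "f z = 0" unfolding f_def grid_sum_def by (intro sum.neutral ballI)
      qed
    qed
    moreover have "f z = 1 \<and> div_grad \<kappa> f z = 0" if z: "ball z (6 * \<epsilon>) \<subseteq> D" for z
    proof
      have f1: "f u = 1" if "u \<in> ball z \<epsilon>" for u
      proof (rule f_one)
        have "ball u (5 * \<epsilon>) \<subseteq> ball z (6 * \<epsilon>)"
          using that by (intro subset_trans[OF subset_ball ball_subset_ball_iff[THEN iffD2]]) (auto simp: dist_commute)
        then show "ball u (5 * \<epsilon>) \<subseteq> D" using z by blast
      qed
      then show "f z = 1" using \<epsilon> by simp
      have "dir_deriv v f u = 0" if "u \<in> ball z \<epsilon>" for u v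
      proof -
        have "(f has_derivative (\<lambda>h. 0)) (at u)"
          by (rule has_derivative_transform_within_open[OF has_derivative_const open_ball that])
             (use f1 in auto)
        then show ?thesis by (rule dir_deriv_eq)
      qed
      then have "dir_deriv v (\<lambda>u. \<kappa> u * dir_deriv v f u) z = 0" for v
        using \<epsilon>
        by (intro dir_deriv_eq[where f' = "\<lambda>h. 0"]
            has_derivative_transform_within_open[OF has_derivative_const[of 0] open_ball[of z \<epsilon>]]) auto
      then show "div_grad \<kappa> f z = 0" by (simp add: div_grad_def)
    qed
    ultimately show "\<exists>f. test_function D f \<and> (\<forall>z\<in>D. \<bar>div_grad \<kappa> f z\<bar> \<le> C / \<epsilon>\<^sup>2) \<and>
      (\<forall>z. ball z (6 * \<epsilon>) \<subseteq> D \<longrightarrow> f z = 1 \<and> div_grad \<kappa> f z = 0)"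
      using bound by blast
  qed
qed

section \<open>Area estimates and boundary charts\<close>

lemma measure_cbox_complex:
  assumes "Re a \<le> Re b" "Im a \<le> Im b"
  shows "measure lebesgue (cbox a b) = (Re b - Re a) * (Im b - Im a)"
  using assms by (simp add: content_cbox Basis_complex_def)

text \<open>The two lower bounds are kept separate because the strip coordinates below are compressed in one
  direction only.\<close>

lemma measure_le_if_expanding:
  fixes f :: "complex \<Rightarrow> complex"
  assumes A: "A \<in> lmeasurable" and W: "W \<in> lmeasurable" "bounded W" "f ` A \<subseteq> W" and ab: "0 < a" "0 < b"
    and exp: "\<And>x y. x \<in> A \<Longrightarrow> y \<in> A \<Longrightarrow> a * \<bar>Re (x - y)\<bar> \<le> norm (f x - f y)"
      "\<And>x y. x \<in> A \<Longrightarrow> y \<in> A \<Longrightarrow> b * \<bar>Im (x - y)\<bar> \<le> norm (f x - f y)"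
  shows "measure lebesgue A * (a * b) \<le> 16 * measure lebesgue W"
proof -
  obtain r where r: "r > 0" "\<And>z. z \<in> W \<Longrightarrow> norm z \<le> r" using W(2) unfolding bounded_pos by blast
  have sub: "W \<subseteq> cbox (Complex (-r) (-r)) (Complex r r)"
  proof
    fix z assume "z \<in> W"
    then have "\<bar>Re z\<bar> \<le> r" "\<bar>Im z\<bar> \<le> r"
      using r(2) abs_Re_le_cmod[of z] abs_Im_le_cmod[of z] order_trans by blast+
    then show "z \<in> cbox (Complex (-r) (-r)) (Complex r r)" by (auto simp: in_cbox_complex_iff)
  qed
  have "measure lebesgue A \<le> 16 / (a * b) * (measure lebesgue W + e)" if e: "e > 0" for e
  proof -
    \<comment> \<open>Cover \<open>W\<close> by nonoverlapping dyadic squares of total area at most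
      \<open>measure lebesgue W + e\<close>, and enclose in a box the part of \<open>A\<close> that
      lands in each of them.\<close>
    obtain \<D> where \<D>: "countable \<D>"
        "\<And>K. K \<in> \<D> \<Longrightarrow> K \<subseteq> cbox (Complex (-r) (-r)) (Complex r r) \<and> K \<noteq> {} \<and> (\<exists>c d. K = cbox c d)"
        "pairwise (\<lambda>A B. interior A \<inter> interior B = {}) \<D>"
        "\<And>u v. cbox u v \<in> \<D> \<Longrightarrow> \<exists>n. \<forall>i \<in> Basis. v \<bullet> i - u \<bullet> i = (Complex r r \<bullet> i - Complex (-r) (-r) \<bullet> i)/2^n"
        "W \<subseteq> \<Union>\<D>" "\<Union>\<D> \<in> lmeasurable" "measure lebesgue (\<Union>\<D>) \<le> measure lebesgue W + e"
      using measurable_outer_intervals_bounded[OF W(1) sub e] by metis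
    have "\<exists>E. E \<in> lmeasurable \<and> measure lebesgue E \<le> 16 / (a * b) * measure lebesgue K \<and>
        (\<forall>z\<in>A. f z \<in> K \<longrightarrow> z \<in> E)" if K: "K \<in> \<D>" for K
    proof (cases "\<exists>z\<in>A. f z \<in> K")
      case False
      then show ?thesis using ab by (intro exI[of _ "{}"]) auto
    next
      case True
      then obtain z0 where z0: "z0 \<in> A" "f z0 \<in> K" by blast
      obtain c d where cd: "K = cbox c d" using \<D>(2)[OF K] by blast
      obtain n where n: "\<forall>i \<in> Basis. d \<bullet> i - c \<bullet> i = (Complex r r \<bullet> i - Complex (-r) (-r) \<bullet> i)/2^n"
        using \<D>(4) K cd by blast
      define l where "l = 2 * r / 2 ^ n"
      have l: "Re d - Re c = l" "Im d - Im c = l" "l > 0"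
        using n r(1) by (auto simp: Basis_complex_def l_def)
      \<comment> \<open>Two points of a square of side \<open>l\<close> are at most
        \<open>2 * l\<close> apart, so their preimages in \<open>A\<close> are within
        \<open>2 * l / a\<close> and \<open>2 * l / b\<close> in the two coordinates. The box around
        \<open>z0\<close> has sides \<open>4 * l / a\<close> and \<open>4 * l / b\<close>; this is
        the origin of the factor 16.\<close>
      define h where "h = Complex (2 * l / a) (2 * l / b)"
      have "measure lebesgue K = l * l"
        using measure_cbox_complex[of c d] l cd by simp
      moreover have "measure lebesgue (cbox (z0 - h) (z0 + h)) = (4 * l / a) * (4 * l / b)"
        using measure_cbox_complex[of "z0 - h" "z0 + h"] l ab by (simp add: h_def)
      ultimately have "measure lebesgue (cbox (z0 - h) (z0 + h)) = 16 / (a * b) * measure lebesgue K"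
        by simp
      moreover have "z \<in> cbox (z0 - h) (z0 + h)" if z: "z \<in> A" "f z \<in> K" for z
      proof -
        have "\<bar>Re (f z - f z0)\<bar> \<le> l" "\<bar>Im (f z - f z0)\<bar> \<le> l"
          using z(2) z0(2) l unfolding cd in_cbox_complex_iff by auto
        then have "norm (f z - f z0) \<le> 2 * l" using cmod_le[of "f z - f z0"] by linarith
        then have "a * \<bar>Re (z - z0)\<bar> \<le> 2 * l" "b * \<bar>Im (z - z0)\<bar> \<le> 2 * l"
          using exp[OF z(1) z0(1)] by linarith+
        then have "\<bar>Re (z - z0)\<bar> \<le> 2 * l / a" "\<bar>Im (z - z0)\<bar> \<le> 2 * l / b"
          using ab by (auto simp: field_simps)
        then show ?thesis by (auto simp: in_cbox_complex_iff h_def abs_le_iff)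
      qed
      ultimately show ?thesis by (intro exI[of _ "cbox (z0 - h) (z0 + h)"]) auto
    qed
    then obtain E where E: "\<And>K. K \<in> \<D> \<Longrightarrow> E K \<in> lmeasurable"
      "\<And>K. K \<in> \<D> \<Longrightarrow> measure lebesgue (E K) \<le> 16 / (a * b) * measure lebesgue K"
      "\<And>K z. K \<in> \<D> \<Longrightarrow> z \<in> A \<Longrightarrow> f z \<in> K \<Longrightarrow> z \<in> E K" by metis
    have fin: "measure lebesgue (\<Union>K\<in>F. E K) \<le> 16 / (a * b) * measure lebesgue (\<Union>\<D>)"
      if F: "F \<subseteq> \<D>" "finite F" for F
    proof -
      have lm: "K \<in> lmeasurable" if "K \<in> F" for K using \<D>(2) F that by blast
      have "measure lebesgue (\<Union>K\<in>F. E K) \<le> (\<Sum>K\<in>F. measure lebesgue (E K))"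
        using F E(1) by (intro measure_UNION_le) (auto intro!: fmeasurableD)
      also have "\<dots> \<le> (\<Sum>K\<in>F. 16 / (a * b) * measure lebesgue K)"
        using F E(2) by (intro sum_mono) auto
      also have "\<dots> = 16 / (a * b) * (\<Sum>K\<in>F. measure lebesgue K)" by (simp add: sum_distrib_left)
      also have "(\<Sum>K\<in>F. measure lebesgue K) = measure lebesgue (\<Union>F)"
      proof (rule measure_negligible_finite_Union[symmetric, OF F(2) lm])
        \<comment> \<open>Distinct squares meet in a convex set with empty interior, which is null,
          so their areas add up.\<close>
        show "pairwise (\<lambda>S T. negligible (S \<inter> T)) F"
        proof (rule pairwiseI)
          fix S T assume ST: "S \<in> F" "T \<in> F" "S \<noteq> T"
          then have "convex (S \<inter> T)" using \<D>(2) F by (metis convex_Int convex_box(1) subsetD)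
          moreover have "interior (S \<inter> T) = {}"
            using ST F(1) \<D>(3) by (auto simp: pairwise_def interior_Int)
          ultimately show "negligible (S \<inter> T)" using negligible_convex_interior by blast
        qed
      qed
      also have "measure lebesgue (\<Union>F) \<le> measure lebesgue (\<Union>\<D>)"
        using F lm \<D>(6) by (intro measure_mono_fmeasurable) (auto intro: fmeasurableD)
      finally show ?thesis using ab by (simp add: mult_left_mono divide_right_mono)
    qed
    have "A \<subseteq> (\<Union>K\<in>\<D>. E K)"
    proof
      fix z assume "z \<in> A"
      then obtain K where "K \<in> \<D>" "f z \<in> K" using W(3) \<D>(5) by blast
      then show "z \<in> (\<Union>K\<in>\<D>. E K)" using E(3) \<open>z \<in> A\<close> by blast
    qed
    moreover have "(\<Union>K\<in>\<D>. E K) \<in> lmeasurable"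
      by (rule fmeasurable_UN_bound[OF \<D>(1) E(1) fin]) auto
    ultimately have "measure lebesgue A \<le> measure lebesgue (\<Union>K\<in>\<D>. E K)"
      using A by (intro measure_mono_fmeasurable) auto
    also have "\<dots> \<le> 16 / (a * b) * measure lebesgue (\<Union>\<D>)"
      by (rule measure_UN_bound[OF \<D>(1) E(1) fin]) auto
    also have "\<dots> \<le> 16 / (a * b) * (measure lebesgue W + e)"
      using ab \<D>(7) by (intro mult_left_mono) auto
    finally show ?thesis .
  qed
  then have "measure lebesgue A * (a * b) / 16 \<le> measure lebesgue W + e" if "e > 0" for e
    using that ab by (simp add: field_simps)
  then have "measure lebesgue A * (a * b) / 16 \<le> measure lebesgue W" by (rule field_le_epsilon)
  then show ?thesis by simp
qed

section \<open>Boundary charts and the outward normal\<close>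

lemma boundary_chart_deriv:
  assumes "boundary_chart D p U \<phi>"
  shows "(\<phi> has_field_derivative deriv \<phi> p) (at p)" "deriv \<phi> p \<noteq> 0"
  using assms holomorphic_injective_imp_regular holomorphic_derivI
  unfolding boundary_chart_def by blast+

text \<open>A chart only records where \<open>Im \<phi>\<close> is positive. A frontier point lies
  outside the open set \<open>D\<close>, which excludes positive values, and it is a limit of points
  of \<open>D\<close>, which by continuity excludes negative ones.\<close>

lemma boundary_chart_Im_eq_0:
  assumes c: "boundary_chart D p U \<phi>" and D: "open D" and q: "q \<in> frontier D" "q \<in> U"
  shows "Im (\<phi> q) = 0"
proof -
  have U: "open U" and cont: "continuous_on U \<phi>" and DU: "D \<inter> U = {z \<in> U. Im (\<phi> z) > 0}"
    using c holomorphic_on_imp_continuous_on by (auto simp: boundary_chart_def)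
  have "q \<notin> D" using q(1) D by (simp add: frontier_def interior_open)
  then have "Im (\<phi> q) \<le> 0" using DU q(2) by force
  moreover have "\<not> Im (\<phi> q) < 0"
  proof
    assume neg: "Im (\<phi> q) < 0"
    let ?V = "U \<inter> \<phi> -` {z. Im z < 0}"
    have "open ?V"
      using continuous_open_preimage[OF cont U open_halfspace_Im_lt] .
    moreover have "q \<in> ?V \<inter> closure D" using neg q by (simp add: frontier_def)
    ultimately have "?V \<inter> D \<noteq> {}" using open_Int_closure_eq_empty[of ?V D] by blast
    then obtain z where "z \<in> D" "z \<in> U" "Im (\<phi> z) < 0" by blast
    then show False using DU by force
  qed
  ultimately show ?thesis by simp
qed

text \<open>The inner product is the derivative of \<open>Im \<phi>\<close> at \<open>p\<close> in
  the direction \<open>h\<close>. Since \<open>Im \<phi>\<close> vanishes at \<open>p\<close>, the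
  sign of this derivative decides on which side of the boundary a short ray starts.\<close>

lemma boundary_chart_direction:
  assumes c: "boundary_chart D p U \<phi>" and p: "Im (\<phi> p) = 0"
  shows "(\<i> * cnj (deriv \<phi> p)) \<bullet> h > 0 \<Longrightarrow> \<forall>\<^sub>F x in at_right 0. p + of_real x * h \<in> D"
    "(\<i> * cnj (deriv \<phi> p)) \<bullet> h < 0 \<Longrightarrow> \<forall>\<^sub>F x in at_right 0. p + of_real x * h \<notin> D"
proof -
  let ?N = "(\<i> * cnj (deriv \<phi> p)) \<bullet> h"
  define u where "u x = Im (\<phi> (p + of_real x * h))" for x
  have U: "open U" "p \<in> U" and DU: "D \<inter> U = {z \<in> U. Im (\<phi> z) > 0}"
    using c by (auto simp: boundary_chart_def)
  have "((\<lambda>x. p + of_real x * h) has_vector_derivative h) (at 0)"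
    by (auto intro!: derivative_eq_intros)
  then have "((\<phi> \<circ> (\<lambda>x. p + of_real x * h)) has_vector_derivative h * deriv \<phi> p) (at 0)"
    by (rule field_vector_diff_chain_at) (use boundary_chart_deriv(1)[OF c] in simp)
  from bounded_linear.has_vector_derivative[OF bounded_linear_Im this]
  have du: "(u has_real_derivative ?N) (at 0)"
    by (simp add: u_def[abs_def] o_def has_real_derivative_iff_has_vector_derivative inner_complex_def algebra_simps)
  have "continuous (at 0) (\<lambda>x::real. p + of_real x * h)" by (intro continuous_intros)
  then have "\<forall>\<^sub>F x in at 0. p + of_real x * h \<in> U"
    using U by (auto simp: continuous_at dest!: topological_tendstoD[of _ _ _ U])
  then have evU: "\<forall>\<^sub>F x in at_right 0. p + of_real x * h \<in> U"
    by (simp add: eventually_at_split)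
  have u0: "u 0 = 0" by (simp add: u_def p)
  show "\<forall>\<^sub>F x in at_right 0. p + of_real x * h \<in> D" if pos: "?N > 0"
  proof -
    obtain d where d: "d > 0" "\<And>x. 0 < x \<Longrightarrow> x < d \<Longrightarrow> u 0 < u (0 + x)"
      using DERIV_pos_inc_right[OF du pos] by blast
    then have "\<forall>\<^sub>F x in at_right 0. u x > 0"
      unfolding eventually_at_right_field by (intro exI[of _ d]) (use u0 in auto)
    with evU show ?thesis by eventually_elim (use DU in \<open>auto simp: u_def\<close>)
  qed
  show "\<forall>\<^sub>F x in at_right 0. p + of_real x * h \<notin> D" if neg: "?N < 0"
  proof -
    obtain d where d: "d > 0" "\<And>x. 0 < x \<Longrightarrow> x < d \<Longrightarrow> u 0 > u (0 + x)"
      using DERIV_neg_dec_right[OF du neg] by blast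
    then have "\<forall>\<^sub>F x in at_right 0. u x < 0"
      unfolding eventually_at_right_field by (intro exI[of _ d]) (use u0 in auto)
    with evU show ?thesis
    proof eventually_elim
      case (elim x)
      show ?case
      proof
        assume "p + of_real x * h \<in> D"
        then have "Im (\<phi> (p + of_real x * h)) > 0" using DU elim(1) by blast
        then show False using elim(2) by (simp add: u_def)
      qed
    qed
  qed
qed

text \<open>The definition allows any chart at \<open>p\<close>, whereas a continuous normal field
  has to come from one fixed chart. If two charts gave distinct unit gradients, their difference
  would be a direction that enters \<open>D\<close> according to one chart and leaves it according
  to the other.\<close>

lemma outward_unit_normal_unique:
  assumes c: "boundary_chart D p U \<phi>" and D: "open D" "p \<in> frontier D"
    and n: "outward_unit_normal D p n"
  shows "n = - sgn (\<i> * cnj (deriv \<phi> p))"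
proof -
  obtain U' \<phi>' where c': "boundary_chart D p U' \<phi>'" and n': "n = - sgn (\<i> * cnj (deriv \<phi>' p))"
    using n unfolding outward_unit_normal_def by blast
  define a where "a = \<i> * cnj (deriv \<phi> p)"
  define b where "b = \<i> * cnj (deriv \<phi>' p)"
  have pU: "p \<in> U" "p \<in> U'" using c c' by (auto simp: boundary_chart_def)
  note z = boundary_chart_Im_eq_0[OF c D pU(1)] boundary_chart_Im_eq_0[OF c' D pU(2)]
  have nz: "a \<noteq> 0" "b \<noteq> 0" using boundary_chart_deriv(2)[OF c] boundary_chart_deriv(2)[OF c']
    by (auto simp: a_def b_def)
  have half: "b \<bullet> h \<ge> 0" if "a \<bullet> h > 0" for h
  proof (rule ccontr)
    assume "\<not> b \<bullet> h \<ge> 0"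
    then have "\<forall>\<^sub>F x in at_right 0. p + of_real x * h \<notin> D"
      using boundary_chart_direction(2)[OF c' z(2)] by (simp add: b_def)
    moreover have "\<forall>\<^sub>F x in at_right 0. p + of_real x * h \<in> D"
      using boundary_chart_direction(1)[OF c z(1)] that by (simp add: a_def)
    ultimately have "\<forall>\<^sub>F x in at_right (0::real). False" by eventually_elim blast
    then show False by (simp add: trivial_limit_at_right_real)
  qed
  have "sgn a = sgn b"
  proof (rule ccontr)
    assume ne: "sgn a \<noteq> sgn b"
    have unit: "norm (sgn a) = 1" "norm (sgn b) = 1" using nz by (auto simp: norm_sgn)
    have lt: "sgn a \<bullet> sgn b < 1"
    proof -
      have "(norm (sgn a - sgn b))\<^sup>2 > 0" using ne by simp
      then show ?thesis
        using unit unfolding power2_norm_eq_inner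
        by (simp add: inner_diff_left inner_diff_right inner_commute norm_eq_1)
    qed
    have "sgn a \<bullet> (sgn a - sgn b) > 0" using unit lt by (simp add: inner_diff_right norm_eq_1)
    then have "a \<bullet> (sgn a - sgn b) > 0" 
      using nz unfolding sgn_div_norm[of a] inner_scaleR_left by (simp only: zero_less_mult_iff) auto
    then have "b \<bullet> (sgn a - sgn b) \<ge> 0" by (rule half)
    then have "sgn b \<bullet> (sgn a - sgn b) \<ge> 0"
      unfolding sgn_div_norm[of b] inner_scaleR_left by (intro mult_nonneg_nonneg) auto
    then show False using unit lt by (simp add: inner_diff_right inner_commute norm_eq_1)
  qed
  then show ?thesis using n' by (simp add: a_def b_def)
qed

section \<open>Analytic parametrization of the boundary\<close>

lemma holomorphic_on_ball_lipschitz: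
  assumes f: "f holomorphic_on ball 0 a" and b: "b < a"
  obtains L where "L > 0" "\<And>x y. x \<in> cball 0 b \<Longrightarrow> y \<in> cball 0 b \<Longrightarrow> norm (f x - f y) \<le> L * norm (x - y)"
proof -
  have sub: "cball 0 b \<subseteq> ball (0::complex) a" using b by auto
  have "continuous_on (cball 0 b) (deriv f)"
    using holomorphic_deriv[OF f open_ball] sub by (meson holomorphic_on_imp_continuous_on continuous_on_subset)
  then have "bounded (deriv f ` cball 0 b)"
    using compact_continuous_image compact_imp_bounded compact_cball by blast
  then obtain L where L: "L > 0" "\<forall>w \<in> deriv f ` cball 0 b. norm w \<le> L"
    unfolding bounded_pos by blast
  have "norm (f x - f y) \<le> L * norm (x - y)" if "x \<in> cball 0 b" "y \<in> cball 0 b" for x y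
  proof (rule field_differentiable_bound[OF convex_cball _ _ that])
    fix z :: complex assume z: "z \<in> cball 0 b"
    show "(f has_field_derivative deriv f z) (at z within cball 0 b)"
      by (rule has_field_derivative_at_within, rule holomorphic_derivI[OF f open_ball]) (use z sub in blast)
    show "norm (deriv f z) \<le> L" using L z by auto
  qed
  then show ?thesis using L(1) that by blast
qed

text \<open>\<open>\<psi>\<close> is the inverse of the chart, shifted so that 0 goes to
  \<open>p\<close>; the real segment then runs along the boundary with \<open>D\<close> on its left.
  From \<open>\<phi>' \<psi>' = 1\<close> it follows that \<open>cnj \<phi>'\<close> is a positive
  multiple of \<open>\<psi>'\<close>, so the outward normal is the unit tangent turned clockwise by
  a right angle. The last clause uses half the radius to stay in a compact interval, on which
  \<open>\<psi>\<close> is Lipschitz.\<close>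

lemma boundary_parametrization:
  assumes c: "boundary_chart D p U \<phi>" and D: "open D" and p: "p \<in> frontier D"
  obtains \<psi> a e where "a > 0" "e > 0" "\<psi> holomorphic_on ball 0 a" "\<psi> 0 = p"
    "\<And>z. z \<in> ball 0 a \<Longrightarrow> deriv \<psi> z \<noteq> 0"
    "\<And>x. \<bar>x\<bar> < a \<Longrightarrow> \<psi> (of_real x) \<in> frontier D"
    "\<And>x. \<bar>x\<bar> < a \<Longrightarrow> boundary_chart D (\<psi> (of_real x)) U \<phi>"
    "\<And>x. \<bar>x\<bar> < a \<Longrightarrow> - sgn (\<i> * cnj (deriv \<phi> (\<psi> (of_real x)))) = - (\<i> * sgn (deriv \<psi> (of_real x)))"
    "frontier D \<inter> ball p e \<subseteq> (\<lambda>x. \<psi> (of_real x)) ` {-(a/2)..a/2}"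
proof -
  have U: "open U" "p \<in> U" and hol: "\<phi> holomorphic_on U" and inj: "inj_on \<phi> U"
    and DU: "D \<inter> U = {z \<in> U. Im (\<phi> z) > 0}"
    using c by (auto simp: boundary_chart_def)
  obtain g where g: "g holomorphic_on \<phi> ` U" "\<And>z. z \<in> U \<Longrightarrow> deriv \<phi> z * deriv g (\<phi> z) = 1"
    "\<And>z. z \<in> U \<Longrightarrow> g (\<phi> z) = z"
    using holomorphic_has_inverse[OF hol U(1) inj] by metis
  have op: "open (\<phi> ` U)" using hol U(1) inj open_mapping_thm3 by blast
  then obtain a where a: "a > 0" "ball (\<phi> p) a \<subseteq> \<phi> ` U"
    using U(2) openE by blast
  define \<psi> where "\<psi> = (\<lambda>z. g (\<phi> p + z))"
  have mem: "\<phi> p + z \<in> \<phi> ` U" if "z \<in> ball 0 a" for z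
    using a(2) that by (auto simp: subset_iff dist_norm)
  have inU: "\<psi> z \<in> U" and \<phi>\<psi>: "\<phi> (\<psi> z) = \<phi> p + z" if z: "z \<in> ball 0 a" for z
  proof -
    obtain u where u: "u \<in> U" "\<phi> u = \<phi> p + z" using mem[OF z] by auto
    then have "\<psi> z = u" using g(3) by (metis \<psi>_def)
    then show "\<psi> z \<in> U" "\<phi> (\<psi> z) = \<phi> p + z" using u by auto
  qed
  have hol\<psi>: "\<psi> holomorphic_on ball 0 a"
  proof -
    have "(\<lambda>z. \<phi> p + z) holomorphic_on ball 0 a" by (intro holomorphic_intros)
    moreover have "(\<lambda>z. \<phi> p + z) ` ball 0 a \<subseteq> \<phi> ` U" using mem by blast
    ultimately show ?thesis
      using holomorphic_on_compose_gen[OF _ g(1)] unfolding \<psi>_def o_def by blast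
  qed
  have d\<psi>: "deriv \<phi> (\<psi> z) * deriv \<psi> z = 1" if z: "z \<in> ball 0 a" for z
  proof -
    have "(g has_field_derivative deriv g (\<phi> p + z)) (at (\<phi> p + z))"
      using holomorphic_derivI[OF g(1) op mem[OF z]] .
    then have "(\<psi> has_field_derivative deriv g (\<phi> p + z) * 1) (at z)"
      unfolding \<psi>_def by (rule DERIV_chain2) (auto intro!: derivative_eq_intros)
    then have "deriv \<psi> z = deriv g (\<phi> (\<psi> z))" using DERIV_imp_deriv \<phi>\<psi>[OF z] by simp
    then show ?thesis using g(2)[OF inU[OF z]] by simp
  qed
  have Im0: "Im (\<phi> p) = 0" using boundary_chart_Im_eq_0[OF c D p U(2)] .
  have fr: "\<psi> (of_real x) \<in> frontier D" if x: "\<bar>x\<bar> < a" for x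
  proof -
    have xb: "complex_of_real x \<in> ball 0 a" using x by simp
    have "\<psi> (of_real x) \<notin> D"
    proof
      assume "\<psi> (of_real x) \<in> D"
      then have "\<psi> (of_real x) \<in> D \<inter> U" using inU[OF xb] by blast
      then show False unfolding DU using \<phi>\<psi>[OF xb] Im0 by simp
    qed
    moreover have "\<psi> (of_real x) \<in> closure D"
    proof -
      have cont: "isCont \<psi> (of_real x)"
        using holomorphic_on_imp_continuous_on[OF hol\<psi>] xb continuous_on_eq_continuous_at[OF open_ball] by blast
      have lim: "((\<lambda>y. of_real x + \<i> * of_real y) \<longlongrightarrow> complex_of_real x + \<i> * of_real 0) (at_right (0::real))"
        by (intro tendsto_intros)
      then have lim': "((\<lambda>y. of_real x + \<i> * of_real y) \<longlongrightarrow> complex_of_real x) (at_right (0::real))" by simp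
      have lim2: "((\<lambda>y. \<psi> (of_real x + \<i> * of_real y)) \<longlongrightarrow> \<psi> (of_real x)) (at_right (0::real))"
        using isCont_tendsto_compose[OF cont lim'] .
      have "\<forall>\<^sub>F y in at_right (0::real). of_real x + \<i> * of_real y \<in> ball (0::complex) a"
        using topological_tendstoD[OF lim' open_ball xb] .
      then have ev: "\<forall>\<^sub>F y in at_right (0::real). \<psi> (of_real x + \<i> * of_real y) \<in> closure D"
        using eventually_at_right_less[of "0::real"]
      proof eventually_elim
        case (elim y)
        then have "\<psi> (of_real x + \<i> * of_real y) \<in> D \<inter> U"
          unfolding DU using inU[OF elim(1)] \<phi>\<psi>[OF elim(1)] Im0 by simp
        then show ?case using closure_subset by blast
      qed
      show ?thesis
        by (rule Lim_in_closed_set[OF closed_closure ev trivial_limit_at_right_real lim2])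
    qed
    ultimately show ?thesis using D by (simp add: frontier_def interior_open)
  qed
  have chart: "boundary_chart D (\<psi> (of_real x)) U \<phi>" if "\<bar>x\<bar> < a" for x
    using c inU[of "of_real x"] that by (simp add: boundary_chart_def)
  have nrm: "- sgn (\<i> * cnj (deriv \<phi> (\<psi> (of_real x)))) = - (\<i> * sgn (deriv \<psi> (of_real x)))"
    if "\<bar>x\<bar> < a" for x
  proof -
    let ?w = "deriv \<psi> (of_real x)"
    have one: "deriv \<phi> (\<psi> (of_real x)) * ?w = 1" using d\<psi>[of "of_real x"] that by simp
    then have "deriv \<phi> (\<psi> (of_real x)) = inverse ?w" by (metis inverse_unique mult.commute)
    then have "sgn (cnj (deriv \<phi> (\<psi> (of_real x)))) = sgn (cnj (inverse ?w))" by simp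
    also have "\<dots> = sgn ?w"
    proof -
      define r where "r = inverse ((norm ?w)\<^sup>2)"
      have "cnj (inverse ?w) = of_real r * ?w"
        using complex_div_cnj[of 1 "cnj ?w"] by (simp add: r_def divide_inverse mult.commute)
      moreover have "r > 0" using one by (auto simp: r_def)
      ultimately show ?thesis by (simp add: sgn_mult sgn_of_real)
    qed
    finally have "sgn (cnj (deriv \<phi> (\<psi> (of_real x)))) = sgn ?w" .
    moreover have "sgn \<i> = \<i>" by (simp add: sgn_eq)
    ultimately show ?thesis by (simp only: sgn_mult)
  qed
  have "isCont \<phi> p"
    using holomorphic_on_imp_continuous_on[OF hol] U continuous_on_eq_continuous_at[OF U(1)] by blast
  then obtain e1 where e1: "e1 > 0" "\<And>q. dist q p < e1 \<Longrightarrow> dist (\<phi> q) (\<phi> p) < a / 2"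
    using a(1) unfolding continuous_at_eps_delta by (metis half_gt_zero)
  obtain e2 where e2: "e2 > 0" "ball p e2 \<subseteq> U" using U openE by blast
  have cover: "frontier D \<inter> ball p (min e1 e2) \<subseteq> (\<lambda>x. \<psi> (of_real x)) ` {-(a/2)..a/2}"
  proof
    fix q assume q: "q \<in> frontier D \<inter> ball p (min e1 e2)"
    then have qU: "q \<in> U" using e2 by auto
    then have "Im (\<phi> q) = 0" using boundary_chart_Im_eq_0[OF c D] q by blast
    then have re: "\<phi> q = \<phi> p + of_real (Re (\<phi> q) - Re (\<phi> p))" using Im0 by (simp add: complex_eq_iff)
    have "dist (\<phi> q) (\<phi> p) < a / 2" using e1(2)[of q] q by (simp add: dist_commute)
    then have "\<bar>Re (\<phi> q) - Re (\<phi> p)\<bar> < a / 2"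
      using abs_Re_le_cmod[of "\<phi> q - \<phi> p"] by (simp add: dist_norm)
    moreover have "\<psi> (of_real (Re (\<phi> q) - Re (\<phi> p))) = q"
      unfolding \<psi>_def re[symmetric] using g(3)[OF qU] .
    ultimately show "q \<in> (\<lambda>x. \<psi> (of_real x)) ` {-(a/2)..a/2}"
      by (intro image_eqI[of _ _ "Re (\<phi> q) - Re (\<phi> p)"]) (simp, unfold atLeastAtMost_iff, linarith)
  qed
  show ?thesis
  proof (rule that[OF a(1) _ hol\<psi> _ _ fr chart nrm cover])
    show "min e1 e2 > 0" using e1 e2 by simp
    show "\<psi> 0 = p" using g(3)[OF U(2)] by (simp add: \<psi>_def)
    show "deriv \<psi> z \<noteq> 0" if "z \<in> ball 0 a" for z using d\<psi>[OF that] by auto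
  qed
qed

text \<open>A substitute for finite length of the boundary.\<close>

definition linear_collar :: "complex set \<Rightarrow> bool" where
  "linear_collar S \<longleftrightarrow> (\<exists>C\<ge>0. \<forall>\<delta>. 0 < \<delta> \<and> \<delta> \<le> 1 \<longrightarrow>
     (\<exists>E. E \<in> lmeasurable \<and> measure lebesgue E \<le> C * \<delta> \<and> (\<forall>q\<in>S. cball q \<delta> \<subseteq> E)))"

lemma linear_collar_subset: "linear_collar T \<Longrightarrow> S \<subseteq> T \<Longrightarrow> linear_collar S"
  unfolding linear_collar_def by (meson subsetD)

lemma linear_collar_empty: "linear_collar {}"
  unfolding linear_collar_def by (intro exI[of _ 0] conjI allI impI exI[of _ "{}"]) auto

lemma linear_collar_Un:
  assumes "linear_collar S" "linear_collar T"
  shows "linear_collar (S \<union> T)"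
proof -
  obtain C where C: "C \<ge> 0" "\<And>\<delta>. 0 < \<delta> \<Longrightarrow> \<delta> \<le> 1 \<Longrightarrow>
     \<exists>E. E \<in> lmeasurable \<and> measure lebesgue E \<le> C * \<delta> \<and> (\<forall>q\<in>S. cball q \<delta> \<subseteq> E)"
    using assms(1) unfolding linear_collar_def by blast
  obtain C' where C': "C' \<ge> 0" "\<And>\<delta>. 0 < \<delta> \<Longrightarrow> \<delta> \<le> 1 \<Longrightarrow>
     \<exists>E. E \<in> lmeasurable \<and> measure lebesgue E \<le> C' * \<delta> \<and> (\<forall>q\<in>T. cball q \<delta> \<subseteq> E)"
    using assms(2) unfolding linear_collar_def by blast
  show ?thesis
    unfolding linear_collar_def
  proof (intro exI[of _ "C + C'"] conjI allI impI)
    fix \<delta> :: real assume \<delta>: "0 < \<delta> \<and> \<delta> \<le> 1"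
    obtain E E' where "E \<in> lmeasurable" "measure lebesgue E \<le> C * \<delta>" "\<forall>q\<in>S. cball q \<delta> \<subseteq> E"
      "E' \<in> lmeasurable" "measure lebesgue E' \<le> C' * \<delta>" "\<forall>q\<in>T. cball q \<delta> \<subseteq> E'"
      using C(2) C'(2) \<delta> by meson
    moreover have "measure lebesgue (E \<union> E') \<le> measure lebesgue E + measure lebesgue E'"
      using calculation by (intro measure_Un_le) (auto intro: fmeasurableD)
    ultimately show "\<exists>E. E \<in> lmeasurable \<and> measure lebesgue E \<le> (C + C') * \<delta> \<and> (\<forall>q\<in>S \<union> T. cball q \<delta> \<subseteq> E)"
      by (intro exI[of _ "E \<union> E'"]) (auto simp: algebra_simps fmeasurable.Un)
  qed (use C C' in auto)
qed

lemma linear_collar_Union: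
  "finite F \<Longrightarrow> (\<And>S. S \<in> F \<Longrightarrow> linear_collar S) \<Longrightarrow> linear_collar (\<Union>F)"
  by (induction F rule: finite_induct) (auto simp: linear_collar_empty intro: linear_collar_Un)

text \<open>Squares around points sampled at parameter spacing \<open>\<delta>\<close> cover the
  collar. There are at most \<open>(b - a) / \<delta> + 1\<close> of them, each of area
  \<open>4 * (L + 1)\<^sup>2 * \<delta>\<^sup>2\<close>; as \<open>\<delta> \<le> 1\<close>, the
  extra square is absorbed into \<open>(b - a + 1) / \<delta>\<close>.\<close>

lemma linear_collar_lipschitz_curve:
  fixes \<gamma> :: "real \<Rightarrow> complex"
  assumes L: "L \<ge> 0" "\<And>x y. x \<in> {a..b} \<Longrightarrow> y \<in> {a..b} \<Longrightarrow> norm (\<gamma> x - \<gamma> y) \<le> L * \<bar>x - y\<bar>" and ab: "a \<le> b"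
  shows "linear_collar (\<gamma> ` {a..b})"
  unfolding linear_collar_def
proof (intro exI[of _ "(b - a + 1) * (4 * (L + 1)\<^sup>2)"] conjI allI impI)
  show "(b - a + 1) * (4 * (L + 1)\<^sup>2) \<ge> 0" using ab by simp
  fix \<delta> :: real assume \<delta>: "0 < \<delta> \<and> \<delta> \<le> 1"
  define N where "N = nat \<lfloor>(b - a) / \<delta>\<rfloor>"
  \<comment> \<open>\<open>L * \<delta>\<close> bounds the way along the curve to the nearest sample
    before it, and another \<open>\<delta>\<close> is the radius of the collar.\<close>
  define r where "r = (L + 1) * \<delta>"
  define Q where "Q k = cbox (\<gamma> (a + real k * \<delta>) - Complex r r) (\<gamma> (a + real k * \<delta>) + Complex r r)" for k
  have r: "r \<ge> 0" using L \<delta> by (simp add: r_def)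
  have mQ: "measure lebesgue (Q k) = 4 * r\<^sup>2" for k
    unfolding Q_def using r by (subst measure_cbox_complex) (auto simp: power2_eq_square)
  have N: "real N \<le> (b - a) / \<delta>" using ab \<delta> by (simp add: N_def)
  show "\<exists>E. E \<in> lmeasurable \<and> measure lebesgue E \<le> (b - a + 1) * (4 * (L + 1)\<^sup>2) * \<delta> \<and>
     (\<forall>q\<in>\<gamma> ` {a..b}. cball q \<delta> \<subseteq> E)"
  proof (intro exI[of _ "\<Union>k\<le>N. Q k"] conjI ballI subsetI)
    show "(\<Union>k\<le>N. Q k) \<in> lmeasurable" by (intro fmeasurable.finite_UN) (auto simp: Q_def)
    have "measure lebesgue (\<Union>k\<le>N. Q k) \<le> (\<Sum>k\<le>N. measure lebesgue (Q k))"
      by (intro measure_UNION_le) (auto simp: Q_def)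
    also have "\<dots> = (real N + 1) * (4 * r\<^sup>2)" by (simp add: mQ algebra_simps)
    also have "\<dots> \<le> ((b - a + 1) / \<delta>) * (4 * r\<^sup>2)"
    proof (rule mult_right_mono)
      have "1 \<le> 1 / \<delta>" using \<delta> by simp
      then show "real N + 1 \<le> (b - a + 1) / \<delta>" using N by (simp add: add_divide_distrib)
    qed simp
    also have "\<dots> = (b - a + 1) * (4 * (L + 1)\<^sup>2) * \<delta>"
      using \<delta> by (simp add: r_def power2_eq_square)
    finally show "measure lebesgue (\<Union>k\<le>N. Q k) \<le> (b - a + 1) * (4 * (L + 1)\<^sup>2) * \<delta>" .
    fix q z assume q: "q \<in> \<gamma> ` {a..b}" and z: "z \<in> cball q \<delta>"
    obtain x where x: "x \<in> {a..b}" "q = \<gamma> x" using q by blast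
    define k where "k = nat \<lfloor>(x - a) / \<delta>\<rfloor>"
    have kr: "real k = of_int \<lfloor>(x - a) / \<delta>\<rfloor>" using x \<delta> by (simp add: k_def)
    then have k1: "real k \<le> (x - a) / \<delta>" "(x - a) / \<delta> < real k + 1" by linarith+
    then have k2: "real k * \<delta> \<le> x - a" "x - a < real k * \<delta> + \<delta>"
      using \<delta> by (auto simp: field_simps)
    have "(x - a) / \<delta> \<le> (b - a) / \<delta>" using x \<delta> by (simp add: divide_right_mono)
    then have kN: "k \<le> N" unfolding k_def N_def by (intro nat_mono floor_mono)
    have "a + real k * \<delta> \<in> {a..b}" using k2 x \<delta> by auto
    then have "norm (\<gamma> x - \<gamma> (a + real k * \<delta>)) \<le> L * \<bar>x - (a + real k * \<delta>)\<bar>"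
      using L(2) x by blast
    also have "\<dots> \<le> L * \<delta>" using k2 L by (intro mult_left_mono) auto
    finally have "norm (z - \<gamma> (a + real k * \<delta>)) \<le> r"
      using z x norm_triangle_ineq[of "z - \<gamma> x" "\<gamma> x - \<gamma> (a + real k * \<delta>)"]
      by (simp add: dist_norm norm_minus_commute r_def algebra_simps)
    then have "\<bar>Re (z - \<gamma> (a + real k * \<delta>))\<bar> \<le> r" "\<bar>Im (z - \<gamma> (a + real k * \<delta>))\<bar> \<le> r"
      using abs_Re_le_cmod abs_Im_le_cmod order_trans by blast+
    then have "z \<in> Q k" by (auto simp: Q_def in_cbox_complex_iff abs_le_iff)
    then show "z \<in> (\<Union>k\<le>N. Q k)" using kN by blast
  qed
qed

text \<open>Near each of its points the boundary lies on a Lipschitz arc, and by compactness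
  finitely many arcs suffice.\<close>

lemma linear_collar_analytic_boundary:
  assumes "bounded_analytic_domain D"
  shows "linear_collar (frontier D)"
proof -
  have D: "open D" "bounded D" "analytic_boundary D" using assms by (auto simp: bounded_analytic_domain_def)
  have "\<exists>e>0. linear_collar (frontier D \<inter> ball p e)" if p: "p \<in> frontier D" for p
  proof -
    obtain U \<phi> where c: "boundary_chart D p U \<phi>" using D(3) p by (auto simp: analytic_boundary_def)
    obtain \<psi> a e where a: "a > 0" "e > 0" "\<psi> holomorphic_on ball 0 a"
      and cover: "frontier D \<inter> ball p e \<subseteq> (\<lambda>x. \<psi> (of_real x)) ` {-(a/2)..a/2}"
      using boundary_parametrization[OF c D(1) p] by metis
    have "a / 2 < a" using a by simp
    then obtain L where L: "L > 0" "\<And>x y. x \<in> cball 0 (a/2) \<Longrightarrow> y \<in> cball 0 (a/2) \<Longrightarrow> norm (\<psi> x - \<psi> y) \<le> L * norm (x - y)"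
      using holomorphic_on_ball_lipschitz[OF a(3)] by metis
    have "linear_collar ((\<lambda>x. \<psi> (of_real x)) ` {-(a/2)..a/2})"
    proof (rule linear_collar_lipschitz_curve)
      fix x y assume "x \<in> {-(a/2)..a/2}" "y \<in> {-(a/2)..a/2}"
      then have "norm (\<psi> (of_real x) - \<psi> (of_real y)) \<le> L * norm (complex_of_real x - of_real y)"
        by (intro L(2)) auto
      then show "norm (\<psi> (of_real x) - \<psi> (of_real y)) \<le> L * \<bar>x - y\<bar>"
        by (simp flip: of_real_diff)
    qed (use L a in auto)
    then show ?thesis using cover a(2) linear_collar_subset by blast
  qed
  then obtain e where e: "\<And>p. p \<in> frontier D \<Longrightarrow> e p > 0"
    "\<And>p. p \<in> frontier D \<Longrightarrow> linear_collar (frontier D \<inter> ball p (e p))" by metis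
  have "compact (frontier D)" using D(2) by (simp add: compact_frontier_bounded)
  moreover have "frontier D \<subseteq> (\<Union>p\<in>frontier D. ball p (e p))" using e(1) by fastforce
  ultimately obtain P where P: "P \<subseteq> frontier D" "finite P" "frontier D \<subseteq> (\<Union>p\<in>P. ball p (e p))"
    using compactE_image[of "frontier D" "frontier D" "\<lambda>p. ball p (e p)"] by (metis open_ball)
  have "linear_collar (\<Union>((\<lambda>p. frontier D \<inter> ball p (e p)) ` P))"
    by (rule linear_collar_Union) (use P e(2) in auto)
  moreover have "frontier D \<subseteq> \<Union>((\<lambda>p. frontier D \<inter> ball p (e p)) ` P)" using P(3) by blast
  ultimately show ?thesis by (rule linear_collar_subset)
qed

section \<open>Normal velocity and area\<close>

text \<open>Multiplied by \<open>norm v\<close>, the difference becomes \<open>v - w\<close> plus a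
  unit or zero vector scaled by \<open>norm w - norm v\<close>, and each part is at most
  \<open>norm (v - w)\<close>. This makes the unit normal Lipschitz along the boundary.\<close>

lemma norm_sgn_diff_le:
  fixes v w :: complex
  assumes "v \<noteq> 0"
  shows "norm (sgn v - sgn w) \<le> 2 * norm (v - w) / norm v"
proof -
  have "norm v * norm (sgn v - sgn w) = norm (v - w + of_real (norm w - norm v) * sgn w)"
  proof -
    have "of_real (norm v) * sgn v = v" using assms by (simp add: sgn_eq)
    moreover have "of_real (norm w) * sgn w = w" by (cases "w = 0") (auto simp: sgn_eq)
    ultimately have "of_real (norm v) * (sgn v - sgn w) = v - w + of_real (norm w - norm v) * sgn w"
      by (simp add: algebra_simps)
    then have "norm (of_real (norm v) * (sgn v - sgn w)) = norm (v - w + of_real (norm w - norm v) * sgn w)"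
      by simp
    then show ?thesis by (simp add: norm_mult)
  qed
  also have "\<dots> \<le> norm (v - w) + norm (of_real (norm w - norm v) * sgn w)" by (rule norm_triangle_ineq)
  also have "norm (of_real (norm w - norm v) * sgn w) \<le> \<bar>norm w - norm v\<bar> * 1"
    unfolding norm_mult norm_of_real by (intro mult_left_mono) (auto simp: norm_sgn)
  also have "\<bar>norm w - norm v\<bar> * 1 \<le> norm (v - w)"
    using norm_triangle_ineq3[of w v] by (simp add: norm_minus_commute)
  finally show ?thesis using assms by (simp add: field_simps)
qed

text \<open>\<open>T x u\<close> is the point at distance \<open>u\<close> from \<open>\<psi> x\<close> on the outward normal.\<close>

lemma normal_coordinates_expanding:
  fixes \<psi> :: "complex \<Rightarrow> complex"
  assumes a: "a > 0" and \<psi>: "\<psi> holomorphic_on ball 0 a" and nz: "\<And>z. z \<in> ball 0 a \<Longrightarrow> deriv \<psi> z \<noteq> 0"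
  defines "T \<equiv> \<lambda>x u. \<psi> (of_real x) - of_real u * (\<i> * sgn (deriv \<psi> (of_real x)))"
  obtains b m :: real where "0 < b" "b \<le> a" "m > 0"
    "\<And>x x' u u'. \<bar>x\<bar> < b \<Longrightarrow> \<bar>x'\<bar> < b \<Longrightarrow> \<bar>u\<bar> < b \<Longrightarrow> \<bar>u'\<bar> < b \<Longrightarrow>
       m * \<bar>x - x'\<bar> \<le> norm (T x u - T x' u') \<and> m * \<bar>u - u'\<bar> \<le> norm (T x u - T x' u')"
proof -
  define \<alpha> where "\<alpha> = deriv \<psi> 0"
  have \<alpha>: "\<alpha> \<noteq> 0" using nz[of 0] a by (simp add: \<alpha>_def)
  define \<mu> where "\<mu> = min 1 (norm \<alpha>)"
  \<comment> \<open>The linearisation at 0 expands by at least \<open>\<mu> / 2\<close> and the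
    errors below add up to at most \<open>2 * \<eta>\<close>, that is \<open>\<mu> / 4\<close>; so
    \<open>\<mu> / 4\<close> is left.\<close>
  define \<eta> where "\<eta> = \<mu> / 8"
  have \<mu>: "\<mu> > 0" "\<mu> \<le> 1" "\<mu> \<le> norm \<alpha>" and \<eta>: "\<eta> > 0" using \<alpha> by (auto simp: \<mu>_def \<eta>_def)
  have hol': "deriv \<psi> holomorphic_on ball 0 a" by (rule holomorphic_deriv[OF \<psi> open_ball])
  \<comment> \<open>The three bounds serve, in turn, the deviation of the curve from its tangent,
    the deviation of the unit normal from its value at 0, and a lower bound for
    \<open>deriv \<psi>\<close>.\<close>
  define \<epsilon> where "\<epsilon> = min \<eta> (min (\<eta> * norm \<alpha> / 2) (norm \<alpha> / 2))"
  have \<epsilon>: "\<epsilon> > 0" "\<epsilon> \<le> \<eta>" "\<epsilon> \<le> \<eta> * norm \<alpha> / 2" "\<epsilon> \<le> norm \<alpha> / 2" using \<eta> \<alpha> by (auto simp: \<epsilon>_def)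
  have "isCont (deriv \<psi>) 0"
    using holomorphic_on_imp_continuous_on[OF hol'] centre_in_ball[of 0 a] a
      continuous_on_eq_continuous_at[OF open_ball] by blast
  then obtain b1 where b1: "b1 > 0" "\<And>z. dist z 0 < b1 \<Longrightarrow> dist (deriv \<psi> z) (deriv \<psi> 0) < \<epsilon>"
    using \<epsilon>(1) unfolding continuous_at_eps_delta by blast
  obtain L where L: "L > 0" "\<And>x y. x \<in> cball 0 (a/2) \<Longrightarrow> y \<in> cball 0 (a/2) \<Longrightarrow>
      norm (deriv \<psi> x - deriv \<psi> y) \<le> L * norm (x - y)"
    by (rule holomorphic_on_ball_lipschitz[OF hol', of "a/2"]) (use a in auto)
  define L' where "L' = 4 * L / norm \<alpha>"
  have L': "L' > 0" using L \<alpha> by (simp add: L'_def)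
  \<comment> \<open>The bound \<open>\<eta> / L'\<close> is needed for the heights: the turning of
    the normal between two base points is multiplied by the height \<open>u'\<close>.\<close>
  define b where "b = min b1 (min (a/2) (\<eta> / L'))"
  have b: "b > 0" "b \<le> b1" "b \<le> a / 2" "b \<le> \<eta> / L'" 
    unfolding b_def using b1(1) a divide_pos_pos[OF \<eta> L'] by linarith+
  have near: "norm (deriv \<psi> z - \<alpha>) \<le> \<epsilon>" if "norm z < b" for z
    using b1(2)[of z] that b by (simp add: \<alpha>_def dist_norm less_imp_le)
  have curve: "norm (\<psi> x - \<psi> y - \<alpha> * (x - y)) \<le> \<eta> * norm (x - y)" if "norm x < b" "norm y < b" for x y
  proof -
    have "norm ((\<psi> x - \<alpha> * x) - (\<psi> y - \<alpha> * y)) \<le> \<eta> * norm (x - y)"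
    proof (rule field_differentiable_bound[of "ball 0 b" _ "\<lambda>z. deriv \<psi> z - \<alpha>"])
      fix z :: complex assume z: "z \<in> ball 0 b"
      then have "z \<in> ball 0 a" using b a by auto
      then have d: "(\<psi> has_field_derivative deriv \<psi> z) (at z within ball 0 b)"
        using holomorphic_derivI[OF \<psi> open_ball] has_field_derivative_at_within by blast
      show "((\<lambda>z. \<psi> z - \<alpha> * z) has_field_derivative deriv \<psi> z - \<alpha>) (at z within ball 0 b)"
        by (rule derivative_eq_intros d refl)+ simp
      show "norm (deriv \<psi> z - \<alpha>) \<le> \<eta>" using near[of z] z \<epsilon> by auto
    qed (use that in auto)
    then show ?thesis by (simp add: algebra_simps)
  qed
  define \<nu> where "\<nu> x = sgn (deriv \<psi> (of_real x))" for x :: real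
  have big: "norm \<alpha> / 2 \<le> norm (deriv \<psi> z)" if "norm z < b" for z
    using near[OF that] \<epsilon>(4) norm_triangle_ineq2[of \<alpha> "deriv \<psi> z"] by (simp add: norm_minus_commute)
  have \<nu>0: "norm (sgn \<alpha> - \<nu> x) \<le> \<eta>" if "\<bar>x\<bar> < b" for x
  proof -
    have "norm (sgn \<alpha> - \<nu> x) \<le> 2 * norm (\<alpha> - deriv \<psi> (of_real x)) / norm \<alpha>"
      unfolding \<nu>_def by (rule norm_sgn_diff_le[OF \<alpha>])
    also have "\<dots> \<le> 2 * (\<eta> * norm \<alpha> / 2) / norm \<alpha>"
      using near[of "of_real x"] that \<epsilon>(3)
      by (intro divide_right_mono mult_left_mono) (auto simp: norm_minus_commute)
    also have "\<dots> = \<eta>" using \<alpha> by simp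
    finally show ?thesis .
  qed
  have \<nu>L: "norm (\<nu> x - \<nu> x') \<le> L' * \<bar>x - x'\<bar>" if x: "\<bar>x\<bar> < b" "\<bar>x'\<bar> < b" for x x'
  proof -
    let ?v = "deriv \<psi> (of_real x)" and ?v' = "deriv \<psi> (of_real x')"
    have v: "norm \<alpha> / 2 \<le> norm ?v" using big[of "of_real x"] x by simp
    then have "?v \<noteq> 0" using \<alpha> by auto
    then have "norm (\<nu> x - \<nu> x') \<le> 2 * norm (?v - ?v') / norm ?v"
      unfolding \<nu>_def by (rule norm_sgn_diff_le)
    also have "\<dots> \<le> 2 * norm (?v - ?v') / (norm \<alpha> / 2)"
      using v \<alpha> by (intro divide_left_mono) (auto intro!: mult_pos_pos)
    also have "\<dots> \<le> 2 * (L * \<bar>x - x'\<bar>) / (norm \<alpha> / 2)"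
    proof -
      have "norm (?v - ?v') \<le> L * norm (complex_of_real x - of_real x')"
        using x b by (intro L(2)) auto
      then have "norm (?v - ?v') \<le> L * \<bar>x - x'\<bar>" by (simp flip: of_real_diff)
      then show ?thesis by (intro divide_right_mono mult_left_mono) auto
    qed
    also have "\<dots> = L' * \<bar>x - x'\<bar>" by (simp add: L'_def)
    finally show ?thesis .
  qed
  have low: "\<mu> / 4 * (\<bar>x - x'\<bar> + \<bar>u - u'\<bar>) \<le> norm (T x u - T x' u')"
    if x: "\<bar>x\<bar> < b" "\<bar>x'\<bar> < b" "\<bar>u\<bar> < b" "\<bar>u'\<bar> < b" for x x' u u'
  proof -
    let ?dx = "x - x'" and ?du = "u - u'"
    \<comment> \<open>\<open>?M\<close> is the linearisation at 0. The errors are the bending of the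
      curve (\<open>?E1\<close>), the deviation of the normal from its value at 0
      (\<open>?E2\<close>), and the turning of the normal between the two base points
      (\<open>?E3\<close>).\<close>
    let ?M = "\<alpha> * of_real ?dx - of_real ?du * (\<i> * sgn \<alpha>)"
    let ?E1 = "\<psi> (of_real x) - \<psi> (of_real x') - \<alpha> * (of_real x - of_real x')"
    let ?E2 = "of_real ?du * (\<i> * (sgn \<alpha> - \<nu> x))"
    let ?E3 = "of_real u' * (\<i> * (\<nu> x - \<nu> x'))"
    have T: "T x u - T x' u' = ?M + (?E1 + ?E2 - ?E3)"
      unfolding T_def \<nu>_def[symmetric] by (simp add: algebra_simps)
    have E1: "norm ?E1 \<le> \<eta> * \<bar>?dx\<bar>"
      using curve[of "of_real x" "of_real x'"] x by (simp flip: of_real_diff)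
    have E2: "norm ?E2 \<le> \<eta> * \<bar>?du\<bar>"
      unfolding norm_mult norm_of_real using mult_left_mono[OF \<nu>0[OF x(1)], of "\<bar>?du\<bar>"]
      by (simp add: mult.commute)
    have E3: "norm ?E3 \<le> \<eta> * \<bar>?dx\<bar>"
    proof -
      have "norm ?E3 = \<bar>u'\<bar> * norm (\<nu> x - \<nu> x')" by (simp add: norm_mult)
      also have "\<dots> \<le> (\<eta> / L') * (L' * \<bar>?dx\<bar>)"
        using x(4) b(4) \<nu>L[OF x(1,2)] \<eta> L' by (intro mult_mono) auto
      finally show ?thesis using L' by simp
    qed
    have "norm (?E1 + ?E2 - ?E3) \<le> norm ?E1 + norm ?E2 + norm ?E3"
      by (intro order_trans[OF norm_triangle_ineq4] add_mono norm_triangle_ineq order_refl)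
    also have "\<dots> \<le> \<eta> * \<bar>?dx\<bar> + \<eta> * \<bar>?du\<bar> + \<eta> * \<bar>?dx\<bar>"
      by (intro add_mono E1 E2 E3)
    also have "\<dots> \<le> 2 * \<eta> * (\<bar>?dx\<bar> + \<bar>?du\<bar>)"
      using \<eta> mult_nonneg_nonneg[of \<eta> "\<bar>?du\<bar>"] by (simp add: algebra_simps)
    finally have E: "norm (?E1 + ?E2 - ?E3) \<le> \<mu> / 4 * (\<bar>?dx\<bar> + \<bar>?du\<bar>)" by (simp add: \<eta>_def)
    \<comment> \<open>Up to the rotation \<open>sgn \<alpha>\<close>, the linearisation is diagonal
      with entries \<open>norm \<alpha>\<close> and \<open>-1\<close>, which explains the minimum in
      \<open>\<mu>\<close>.\<close>
    have "?M = sgn \<alpha> * Complex (norm \<alpha> * ?dx) (- ?du)"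
    proof -
      have "of_real (norm \<alpha>) * sgn \<alpha> = \<alpha>" using \<alpha> by (simp add: sgn_eq)
      then have "?M = of_real (norm \<alpha>) * sgn \<alpha> * of_real ?dx - of_real ?du * (\<i> * sgn \<alpha>)" by simp
      also have "\<dots> = sgn \<alpha> * (of_real (norm \<alpha> * ?dx) + \<i> * of_real (- ?du))"
        by (simp add: algebra_simps)
      finally show ?thesis by (simp add: complex_eq_iff)
    qed
    then have M: "norm ?M = norm (Complex (norm \<alpha> * ?dx) (- ?du))"
      using \<alpha> by (simp add: norm_mult norm_sgn)
    have "norm \<alpha> * \<bar>?dx\<bar> \<le> norm ?M" "\<bar>?du\<bar> \<le> norm ?M"
      unfolding M using abs_Re_le_cmod[of "Complex (norm \<alpha> * ?dx) (- ?du)"]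
        abs_Im_le_cmod[of "Complex (norm \<alpha> * ?dx) (- ?du)"] by (auto simp: abs_mult)
    moreover have "\<mu> * \<bar>?dx\<bar> \<le> norm \<alpha> * \<bar>?dx\<bar>" "\<mu> * \<bar>?du\<bar> \<le> 1 * \<bar>?du\<bar>"
      using \<mu> by (intro mult_right_mono; simp)+
    ultimately have "\<mu> / 2 * (\<bar>?dx\<bar> + \<bar>?du\<bar>) \<le> norm ?M" by (simp add: algebra_simps)
    moreover have "norm ?M - norm (?E1 + ?E2 - ?E3) \<le> norm (T x u - T x' u')"
      unfolding T by (rule norm_diff_ineq)
    ultimately show ?thesis using E by (simp add: algebra_simps)
  qed
  show ?thesis
  proof (rule that[of b "\<mu> / 4"])
    fix x x' u u' :: real
    assume "\<bar>x\<bar> < b" "\<bar>x'\<bar> < b" "\<bar>u\<bar> < b" "\<bar>u'\<bar> < b"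
    from low[OF this] have *: "\<mu> / 4 * \<bar>x - x'\<bar> + \<mu> / 4 * \<bar>u - u'\<bar> \<le> norm (T x u - T x' u')"
      by (simp add: distrib_left)
    moreover have "0 \<le> \<mu> / 4 * \<bar>x - x'\<bar>" "0 \<le> \<mu> / 4 * \<bar>u - u'\<bar>" using \<mu> by auto
    ultimately show "\<mu> / 4 * \<bar>x - x'\<bar> \<le> norm (T x u - T x' u') \<and> \<mu> / 4 * \<bar>u - u'\<bar> \<le> norm (T x u - T x' u')"
      by linarith
  qed (use b a \<mu> in auto)
qed

text \<open>Everything is pulled back to one fixed rectangle by maps that compress the normal
  direction by the time step. A subset of positive measure whose images all lie in the newly gained
  region would make the area grow at least linearly in the time step.\<close>

lemma boundary_velocity_le_0:
  fixes D :: "real \<Rightarrow> complex set"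
  assumes op: "\<And>t. 0 \<le> t \<Longrightarrow> open (D t)" and bd: "\<And>t. 0 \<le> t \<Longrightarrow> bounded (D t)"
    and growing: "\<And>s t. 0 \<le> s \<Longrightarrow> s \<le> t \<Longrightarrow> D s \<subseteq> D t"
    and t0: "0 \<le> t0"
    and area: "((\<lambda>t. measure lebesgue (D t)) has_real_derivative 0) (at t0 within {0..})"
    and chart: "boundary_chart (D t0) p U \<phi>" and p: "p \<in> frontier (D t0)"
    and V: "continuous_on (frontier (D t0) \<inter> U) V"
    and vel: "\<And>q n. q \<in> frontier (D t0) \<inter> U \<Longrightarrow> outward_unit_normal (D t0) q n \<Longrightarrow>
      has_normal_velocity D t0 q n (V q)"
  shows "V p \<le> 0"
proof (rule ccontr)
  assume "\<not> V p \<le> 0"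
  then have Vp: "V p > 0" by simp
  obtain \<psi> a e where a: "a > 0" and \<psi>: "\<psi> holomorphic_on ball 0 a" "\<psi> 0 = p"
    and nz: "\<And>z. z \<in> ball 0 a \<Longrightarrow> deriv \<psi> z \<noteq> 0"
    and fr: "\<And>x. \<bar>x\<bar> < a \<Longrightarrow> \<psi> (of_real x) \<in> frontier (D t0)"
    and ch: "\<And>x. \<bar>x\<bar> < a \<Longrightarrow> boundary_chart (D t0) (\<psi> (of_real x)) U \<phi>"
    and nrm: "\<And>x. \<bar>x\<bar> < a \<Longrightarrow> - sgn (\<i> * cnj (deriv \<phi> (\<psi> (of_real x)))) = - (\<i> * sgn (deriv \<psi> (of_real x)))"
    using boundary_parametrization[OF chart op[OF t0] p] by (metis (no_types, lifting))
  have frU: "\<psi> (of_real x) \<in> frontier (D t0) \<inter> U" if "\<bar>x\<bar> < a" for x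
    using fr[OF that] ch[OF that] by (auto simp: boundary_chart_def)
  define T where "T = (\<lambda>x u. \<psi> (of_real x) - of_real u * (\<i> * sgn (deriv \<psi> (of_real x))))"
  obtain b m :: real where b: "0 < b" "b \<le> a" and m: "m > 0"
    and expand: "\<And>x x' u u'. \<bar>x\<bar> < b \<Longrightarrow> \<bar>x'\<bar> < b \<Longrightarrow> \<bar>u\<bar> < b \<Longrightarrow> \<bar>u'\<bar> < b \<Longrightarrow>
       m * \<bar>x - x'\<bar> \<le> norm (T x u - T x' u') \<and> m * \<bar>u - u'\<bar> \<le> norm (T x u - T x' u')"
    unfolding T_def by (rule normal_coordinates_expanding[OF a \<psi>(1) nz]) blast+
  have sub: "complex_of_real x \<in> ball 0 a" if "\<bar>x\<bar> < a" for x using that by simp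
  have cont\<psi>: "continuous_on (ball 0 a) \<psi>" "continuous_on (ball 0 a) (deriv \<psi>)"
    using \<psi>(1) holomorphic_deriv[OF \<psi>(1) open_ball] holomorphic_on_imp_continuous_on by blast+
  obtain b0 where b0: "b0 > 0" "\<And>x. \<bar>x\<bar> < b0 \<Longrightarrow> \<bar>x\<bar> < a \<Longrightarrow> V (\<psi> (of_real x)) > V p / 2"
  proof -
    have "continuous_on {-a<..<a} (\<lambda>x. V (\<psi> (complex_of_real x)))"
      by (rule continuous_on_compose2[OF V continuous_on_compose2[OF cont\<psi>(1)]])
         (use frU sub in \<open>auto intro!: continuous_intros simp: abs_less_iff\<close>)
    then have "isCont (\<lambda>x. V (\<psi> (complex_of_real x))) 0"
      unfolding continuous_on_eq_continuous_at[OF open_greaterThanLessThan] using a by force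
    then obtain d where d: "d > 0" "\<And>x. dist x 0 < d \<Longrightarrow>
        dist (V (\<psi> (complex_of_real x))) (V (\<psi> (complex_of_real 0))) < V p / 2"
      using Vp unfolding continuous_at_eps_delta by (metis half_gt_zero)
    show ?thesis
    proof (rule that[OF d(1)])
      fix x :: real assume "\<bar>x\<bar> < d"
      then have "\<bar>V (\<psi> (of_real x)) - V p\<bar> < V p / 2"
        using d(2)[of x] by (simp only: dist_real_def \<psi>(2) of_real_0 diff_0_right)
      then show "V (\<psi> (of_real x)) > V p / 2" by linarith
    qed
  qed
  \<comment> \<open>For \<open>\<bar>x\<bar> < \<beta>\<close> the velocity exceeds
    \<open>V p / 2\<close>, hence every height below \<open>\<gamma>\<close>. Bounding
    \<open>\<gamma>\<close> by \<open>b\<close> keeps the heights \<open>Im z * h j\<close> within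
    the range of the normal coordinates, as \<open>h j \<le> 1\<close>.\<close>
  define \<beta> where "\<beta> = min b b0"
  define \<gamma> where "\<gamma> = min (V p / 2) b"
  have \<beta>: "\<beta> > 0" "\<beta> \<le> b" "\<beta> \<le> b0" "\<beta> \<le> a" and \<gamma>: "\<gamma> > 0" "\<gamma> \<le> V p / 2" "\<gamma> \<le> b"
    using b b0(1) Vp by (auto simp: \<beta>_def \<gamma>_def)
  \<comment> \<open>A sequence of times is enough to contradict the derivative of the area, and it
    makes the exhausting sets countable intersections of Borel sets.\<close>
  define h where "h j = 1 / real (Suc j)" for j
  define s where "s j = t0 + h j" for j
  have h: "h j > 0" "h j \<le> 1" for j by (auto simp: h_def)
  have s: "s j > t0" "0 \<le> s j" for j using h[of j] t0 by (auto simp: s_def)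
  have h0: "h \<longlonglongrightarrow> 0" unfolding h_def[abs_def] by (rule LIMSEQ_Suc[OF lim_1_over_n])
  have slim: "s \<longlonglongrightarrow> t0"
    unfolding s_def[abs_def] using tendsto_add[OF tendsto_const h0, of t0] by simp
  have sF: "filterlim s (at t0 within {0..}) sequentially"
    unfolding filterlim_at using slim s by (auto intro!: always_eventually simp: less_imp_neq[THEN not_sym])
  define F where "F j z = T (Re z) (Im z * h j)" for j z
  define Bx where "Bx = box (Complex (-\<beta>) 0) (Complex \<beta> \<gamma>)"
  have Bx: "z \<in> Bx \<longleftrightarrow> \<bar>Re z\<bar> < \<beta> \<and> 0 < Im z \<and> Im z < \<gamma>" for z
    by (auto simp: Bx_def in_box_complex_iff)
  have small: "\<bar>Im z * h j\<bar> < b" if "z \<in> Bx" for z j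
  proof -
    have "\<bar>Im z * h j\<bar> \<le> Im z * 1"
      using that h[of j] unfolding Bx by (simp add: abs_mult mult_left_le)
    then show ?thesis using that \<gamma> unfolding Bx by linarith
  qed
  have contF: "continuous_on Bx (F j)" for j
  proof -
    have im: "(\<lambda>z. complex_of_real (Re z)) ` Bx \<subseteq> ball 0 a"
      using \<beta> by (auto simp: Bx)
    have c: "continuous_on Bx (\<lambda>z. complex_of_real (Re z))" by (intro continuous_intros)
    have "continuous_on Bx (\<lambda>z. \<psi> (of_real (Re z)))" "continuous_on Bx (\<lambda>z. deriv \<psi> (of_real (Re z)))"
      using continuous_on_compose2[OF cont\<psi>(1) c im] continuous_on_compose2[OF cont\<psi>(2) c im] .
    moreover have "\<forall>z\<in>Bx. deriv \<psi> (of_real (Re z)) \<noteq> 0" using im nz by blast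
    ultimately show ?thesis
      unfolding F_def[abs_def] T_def by (intro continuous_intros) auto
  qed
  have F_diff: "m * \<bar>Re (x - y)\<bar> \<le> norm (F j x - F j y)" "(m * h j) * \<bar>Im (x - y)\<bar> \<le> norm (F j x - F j y)"
    if "x \<in> Bx" "y \<in> Bx" for x y j
  proof -
    have "m * \<bar>Re x - Re y\<bar> \<le> norm (F j x - F j y) \<and> m * \<bar>Im x * h j - Im y * h j\<bar> \<le> norm (F j x - F j y)"
      unfolding F_def using that \<beta> by (intro expand small that) (auto simp: Bx)
    moreover have "\<bar>Im x * h j - Im y * h j\<bar> = h j * \<bar>Im x - Im y\<bar>"
      using h(1)[of j] by (simp add: abs_mult flip: left_diff_distrib)
    ultimately show "m * \<bar>Re (x - y)\<bar> \<le> norm (F j x - F j y)"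
      "(m * h j) * \<bar>Im (x - y)\<bar> \<le> norm (F j x - F j y)" by (auto simp: mult.assoc)
  qed
  \<comment> \<open>\<open>F j\<close> maps \<open>Bx\<close> onto a strip of width proportional to \<open>h j\<close>; the sets \<open>A k\<close> exhaust \<open>Bx\<close> by the
    pointwise velocity bound, and each is null by the area hypothesis.\<close>
  define A where "A k = {z \<in> Bx. \<forall>j\<ge>k. F j z \<in> D (s j) - D t0}" for k
  have opBx: "open Bx" "bounded Bx" by (auto simp: Bx_def open_box bounded_box)
  have Ameas: "A k \<in> lmeasurable" for k
  proof -
    have "A k = (\<Inter>j\<in>{k..}. (Bx \<inter> F j -` D (s j)) - (Bx \<inter> F j -` D t0))"
      by (auto simp: A_def)
    moreover have "(Bx \<inter> F j -` D (s j)) - (Bx \<inter> F j -` D t0) \<in> sets borel" for j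
      using continuous_open_preimage[OF contF opBx(1) op] s(2) t0 by (intro sets.Diff) auto
    ultimately have "A k \<in> sets borel"
      by (auto intro!: sets.countable_INT'')
    moreover have "bounded (A k)" using opBx(2) by (rule bounded_subset) (auto simp: A_def)
    ultimately show ?thesis by (intro bounded_set_imp_lmeasurable) auto
  qed
  have Dmeas: "D t \<in> lmeasurable" if "0 \<le> t" for t
    using op bd that by (intro bounded_set_imp_lmeasurable) auto
  have A0: "measure lebesgue (A k) = 0" for k
  proof -
    let ?q = "\<lambda>j. (measure lebesgue (D (s j)) - measure lebesgue (D t0)) / (s j - t0)"
    \<comment> \<open>The compression factor \<open>h j\<close> is also the time step. Dividing by
      it bounds a quantity independent of \<open>j\<close> by the difference quotient of the area,
      which tends to 0.\<close>
    have bound: "measure lebesgue (A k) * (m * m) \<le> 16 * ?q j" if "j \<ge> k" for j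
    proof -
      have "measure lebesgue (A k) * (m * (m * h j)) \<le> 16 * measure lebesgue (D (s j) - D t0)"
      proof (rule measure_le_if_expanding[OF Ameas])
        show "D (s j) - D t0 \<in> lmeasurable" using Dmeas s(2) t0 by (intro fmeasurable.Diff) auto
        show "bounded (D (s j) - D t0)" using bd[OF s(2)] by (rule bounded_subset) auto
        show "F j ` A k \<subseteq> D (s j) - D t0" using that by (auto simp: A_def)
      qed (use m h F_diff in \<open>auto simp: A_def\<close>)
      also have "measure lebesgue (D (s j) - D t0) = measure lebesgue (D (s j)) - measure lebesgue (D t0)"
        using Dmeas[OF s(2)[of j]] Dmeas[OF t0] growing[OF t0 less_imp_le[OF s(1)]]
        by (intro measurable_measure_Diff) auto
      finally show ?thesis using h(1)[of j] by (simp add: s_def field_simps)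
    qed
    have "((\<lambda>t. (measure lebesgue (D t) - measure lebesgue (D t0)) / (t - t0)) \<longlongrightarrow> 0) (at t0 within {0..})"
      using area by (simp add: has_field_derivative_iff)
    then have "?q \<longlonglongrightarrow> 0" using filterlim_compose sF by blast
    then have "(\<lambda>j. 16 * ?q j) \<longlonglongrightarrow> 16 * 0" by (intro tendsto_mult tendsto_const)
    then have "measure lebesgue (A k) * (m * m) \<le> 16 * 0"
      by (rule tendsto_lowerbound) (use bound in \<open>auto simp: eventually_sequentially\<close>)
    then have "measure lebesgue (A k) \<le> 0" using m by (auto simp: mult_le_0_iff)
    then show ?thesis using measure_nonneg[of lebesgue "A k"] by linarith
  qed
  \<comment> \<open>For a fixed \<open>z\<close> of height \<open>y\<close>, the displacement at
    time \<open>s j\<close> eventually exceeds \<open>y * h j\<close>, because the velocity at the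
    base point exceeds \<open>y\<close>; and a short outward step leaves \<open>D t0\<close>. The
    index from which this holds depends on \<open>z\<close>, hence the union over
    \<open>k\<close>.\<close>
  have "Bx \<subseteq> (\<Union>k. A k)"
  proof
    fix z assume z: "z \<in> Bx"
    define x y where "x = Re z" and "y = Im z"
    have xy: "\<bar>x\<bar> < \<beta>" "0 < y" "y < \<gamma>" using z by (auto simp: x_def y_def Bx)
    define q where "q = \<psi> (of_real x)"
    define n where "n = - sgn (\<i> * cnj (deriv \<phi> q))"
    have xa: "\<bar>x\<bar> < a" using xy \<beta> by simp
    have Fz: "F j z = q + of_real (y * h j) * n" for j
      using nrm[OF xa] by (simp add: F_def T_def q_def n_def x_def y_def)
    have q: "q \<in> frontier (D t0)" and cq: "boundary_chart (D t0) q U \<phi>"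
      using fr[OF xa] ch[OF xa] by (auto simp: q_def)
    have "outward_unit_normal (D t0) q n" using cq by (auto simp: outward_unit_normal_def n_def)
    from vel[OF _ this] frU[OF xa] obtain r \<delta> where r: "r > 0" "\<delta> t0 = 0"
      and \<delta>: "(\<delta> has_real_derivative V q) (at t0 within {0..})"
      and ev: "\<forall>\<^sub>F t in at t0 within {0..}. \<forall>x. \<bar>x\<bar> < r \<longrightarrow> (q + of_real x * n \<in> D t \<longleftrightarrow> x < \<delta> t)"
      unfolding has_normal_velocity_def q_def by blast
    have qU: "q \<in> U" using cq by (simp add: boundary_chart_def)
    have nzq: "deriv \<phi> q \<noteq> 0" using boundary_chart_deriv(2)[OF cq] .
    have "(\<i> * cnj (deriv \<phi> q)) \<bullet> n < 0"
      using nzq by (simp add: n_def sgn_div_norm zero_less_mult_iff norm_mult)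
    then have out: "\<forall>\<^sub>F u in at_right 0. q + of_real u * n \<notin> D t0"
      using boundary_chart_direction(2)[OF cq boundary_chart_Im_eq_0[OF cq op[OF t0] q qU]] by blast
    have yh: "filterlim (\<lambda>j. y * h j) (at_right 0) sequentially"
      unfolding filterlim_at using tendsto_mult[OF tendsto_const h0, of y] xy h
      by (auto intro!: always_eventually simp: less_imp_neq[THEN not_sym] mult_pos_pos)
    have e1: "\<forall>\<^sub>F j in sequentially. q + of_real (y * h j) * n \<notin> D t0"
      using filterlim_iff[THEN iffD1, OF yh] out by blast
    have e2: "\<forall>\<^sub>F j in sequentially. \<forall>x. \<bar>x\<bar> < r \<longrightarrow> (q + of_real x * n \<in> D (s j) \<longleftrightarrow> x < \<delta> (s j))"
      using filterlim_iff[THEN iffD1, OF sF] ev by blast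
    have "(\<lambda>j. y * h j) \<longlonglongrightarrow> 0" using tendsto_mult[OF tendsto_const h0, of y] by simp
    then have e3: "\<forall>\<^sub>F j in sequentially. y * h j < r" using r(1) order_tendstoD(2) by blast
    have Vq: "V q > y" using b0(2)[of x] xy \<beta> \<gamma> xa by (simp add: q_def)
    have "((\<lambda>t. \<delta> t / (t - t0)) \<longlongrightarrow> V q) (at t0 within {0..})"
      using \<delta> r(2) by (simp add: has_field_derivative_iff)
    then have "(\<lambda>j. \<delta> (s j) / (s j - t0)) \<longlonglongrightarrow> V q" using filterlim_compose sF by blast
    then have e4: "\<forall>\<^sub>F j in sequentially. y < \<delta> (s j) / (s j - t0)" using Vq order_tendstoD(1) by blast
    have "\<forall>\<^sub>F j in sequentially. F j z \<in> D (s j) - D t0"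
      using e1 e2 e3 e4
    proof eventually_elim
      case (elim j)
      have "y * h j < \<delta> (s j)" using elim(4) h(1)[of j] by (simp add: s_def field_simps)
      moreover have "\<bar>y * h j\<bar> < r" using elim(3) xy h(1)[of j] by simp
      ultimately show ?case using elim(1,2) unfolding Fz by blast
    qed
    then show "z \<in> (\<Union>k. A k)" using z by (auto simp: A_def eventually_sequentially)
  qed
  moreover have "negligible (\<Union>k. A k)"
    using A0 Ameas by (intro negligible_countable_Union) (auto simp: negligible_iff_measure)
  ultimately have "negligible Bx" by (rule negligible_subset[rotated])
  then have "Bx = {}" unfolding Bx_def using negligible_interval(2) by blast
  moreover have "Complex 0 (\<gamma> / 2) \<in> Bx" using \<beta> \<gamma> by (simp add: Bx)
  ultimately show False by blast
qed

text \<open>A negative displacement would put points just behind \<open>p\<close>, which belong to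
  \<open>D t\<close>, outside the larger \<open>D s\<close>. The limit is taken from the right
  because growth gives the inclusion for later times.\<close>

lemma has_normal_velocity_nonneg:
  assumes vel: "has_normal_velocity D t p n v" and t: "0 \<le> t"
    and growing: "\<And>s. t \<le> s \<Longrightarrow> D t \<subseteq> D s"
    and inside: "\<forall>\<^sub>F x in at_right 0. p - of_real x * n \<in> D t"
  shows "0 \<le> v"
proof -
  obtain r \<delta> where r: "r > 0" "\<delta> t = 0" and \<delta>: "(\<delta> has_real_derivative v) (at t within {0..})"
    and ev: "\<forall>\<^sub>F s in at t within {0..}. \<forall>x. \<bar>x\<bar> < r \<longrightarrow> (p + of_real x * n \<in> D s \<longleftrightarrow> x < \<delta> s)"
    using vel unfolding has_normal_velocity_def by blast
  obtain d where d: "d > 0" "\<And>x. 0 < x \<Longrightarrow> x < d \<Longrightarrow> p - of_real x * n \<in> D t"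
    using inside unfolding eventually_at_right_field by auto
  have le: "at_right t \<le> at t within {0..}" using t by (intro at_le) auto
  have lim: "((\<lambda>s. \<delta> s / (s - t)) \<longlongrightarrow> v) (at_right t)"
    using \<delta> r(2) tendsto_mono[OF le] by (simp add: has_field_derivative_iff)
  have "\<forall>\<^sub>F s in at_right t. 0 \<le> \<delta> s / (s - t)"
    using filter_leD[OF le ev] eventually_at_right_less[of t]
  proof eventually_elim
    case (elim s)
    have "0 \<le> \<delta> s"
    proof (rule ccontr)
      assume neg: "\<not> 0 \<le> \<delta> s"
      define x where "x = min (d / 2) (min (r / 2) (- \<delta> s / 2))"
      have x: "0 < x" "x < d" "x < r" "x < - \<delta> s" using d(1) r(1) neg by (auto simp: x_def min_def)
      have "p + of_real (- x) * n \<in> D s" using d(2)[OF x(1,2)] growing[of s] elim(2) by auto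
      then have "- x < \<delta> s" using elim(1)[rule_format, of "-x"] x by simp
      then show False using x by simp
    qed
    then show ?case using elim(2) by simp
  qed
  then show ?thesis using tendsto_lowerbound[OF lim] trivial_limit_at_right_real by blast
qed

section \<open>Vanishing gradient on the boundary\<close>

text \<open>A ball is connected, so if it met both \<open>D\<close> and its complement it would meet
  the frontier.\<close>

lemma ball_subset_if_le_infdist_frontier:
  fixes D :: "'a::euclidean_space set"
  assumes "z \<in> D" "r \<le> infdist z (frontier D)"
  shows "ball z r \<subseteq> D"
proof (rule ccontr)
  assume n: "\<not> ball z r \<subseteq> D"
  then have "r > 0" using ball_eq_empty[of z r] by (metis empty_subsetI not_le)
  then have "z \<in> ball z r \<inter> D" using assms(1) by simp
  then have "ball z r \<inter> frontier D \<noteq> {}"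
    using n by (intro connected_Int_frontier connected_ball) blast+
  then obtain x where "dist z x < r" "x \<in> frontier D" by auto
  then show False using infdist_le[of x "frontier D" z] assms(2) by simp
qed

text \<open>This is the mean value inequality along the segment from \<open>z\<close> to a nearest
  frontier point \<open>q\<close>. The segment stays in the closure because the open ball around
  \<open>z\<close> through \<open>q\<close> lies in \<open>D\<close>, and on it the gradient is
  within \<open>\<eta>\<close> of its value 0 at \<open>q\<close> by uniform continuity.\<close>

lemma small_near_frontier:
  fixes G :: "complex \<Rightarrow> complex" and g :: "complex \<Rightarrow> real"
  assumes D: "open D" "bounded D" "w \<in> D"
    and G: "continuous_on (closure D - {w}) G"
    and g: "\<And>z. z \<in> closure D - {w} \<Longrightarrow> (g has_derivative (\<lambda>h. G z \<bullet> h)) (at z within closure D - {w})"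
    and g0: "\<And>z. z \<in> frontier D \<Longrightarrow> g z = 0" and G0: "\<And>z. z \<in> frontier D \<Longrightarrow> G z = 0"
    and ne: "frontier D \<noteq> {}" and \<eta>: "\<eta> > 0"
  obtains d where "d > 0"
    "\<And>z. z \<in> D \<Longrightarrow> infdist z (frontier D) < d \<Longrightarrow> \<bar>g z\<bar> \<le> \<eta> * infdist z (frontier D)"
proof -
  have "w \<notin> frontier D" using D by (simp add: frontier_def interior_open)
  then have wpos: "infdist w (frontier D) > 0"
    using in_closed_iff_infdist_zero[OF frontier_closed ne] infdist_nonneg[of w "frontier D"] by force
  \<comment> \<open>Half the distance keeps the compact set \<open>S\<close> away from
    \<open>w\<close>, so that \<open>G\<close> is continuous on it.\<close>
  define \<rho> where "\<rho> = infdist w (frontier D) / 2"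
  define S where "S = closure D \<inter> {z. infdist z (frontier D) \<le> \<rho>}"
  have "closed {z. infdist z (frontier D) \<le> \<rho>}" by (intro closed_Collect_le continuous_intros)
  then have "compact S" unfolding S_def using D(2) by (intro compact_Int_closed) auto
  moreover have sub: "S \<subseteq> closure D - {w}" using wpos by (auto simp: S_def \<rho>_def)
  ultimately have "uniformly_continuous_on S G"
    using G continuous_on_subset compact_uniformly_continuous by blast
  then obtain \<delta> where \<delta>: "\<delta> > 0" "\<And>x y. x \<in> S \<Longrightarrow> y \<in> S \<Longrightarrow> dist y x < \<delta> \<Longrightarrow> dist (G y) (G x) < \<eta>"
    using \<eta> unfolding uniformly_continuous_on_def by meson
  show ?thesis
  proof (rule that[of "min \<rho> \<delta>"])
    show "min \<rho> \<delta> > 0" using wpos \<delta> by (simp add: \<rho>_def)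
    fix z assume z: "z \<in> D" "infdist z (frontier D) < min \<rho> \<delta>"
    obtain q where q: "q \<in> frontier D" "infdist z (frontier D) = dist z q"
      using infdist_attains_inf[OF frontier_closed ne] by metis
    have ball: "ball z (dist z q) \<subseteq> D"
      using ball_subset_if_le_infdist_frontier[OF z(1)] q(2) by simp
    have seg: "u \<in> S \<and> dist u q < \<delta>" if u: "u \<in> closed_segment z q" for u
    proof -
      have uq: "dist u q \<le> dist z q" "dist z u \<le> dist z q"
        using segment_bound[OF u] by (auto simp: dist_norm norm_minus_commute)
      have "u \<in> closure D"
      proof (cases "u = q")
        case True then show ?thesis using q(1) by (simp add: frontier_def)
      next
        case False
        have "dist z u < dist z q"
        proof (cases "u = z")
          case True then show ?thesis using False by simp
        next
          case nz: False
          then have "u \<in> open_segment z q" using u False by (simp add: open_segment_def)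
          then show ?thesis using dist_in_open_segment dist_commute by metis
        qed
        then have "u \<in> D" using ball by auto
        then show ?thesis using closure_subset by blast
      qed
      moreover have "infdist u (frontier D) \<le> dist u q" using infdist_le[OF q(1)] .
      ultimately show ?thesis using uq z(2) q(2) by (auto simp: S_def)
    qed
    have qS: "q \<in> S" using seg[of q] by simp
    have "norm (g z - g q) \<le> \<eta> * norm (z - q)"
    proof (rule differentiable_bound[of "closed_segment z q" g "\<lambda>u h. G u \<bullet> h"])
      fix u assume u: "u \<in> closed_segment z q"
      show "(g has_derivative (\<lambda>h. G u \<bullet> h)) (at u within closed_segment z q)"
        using g[of u] seg u sub by (meson has_derivative_subset subsetD subsetI)
      have "norm (G u) \<le> \<eta>"
        using \<delta>(2)[OF qS, of u] seg[OF u] G0[OF q(1)] by (simp add: less_imp_le)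
      then show "onorm (\<lambda>h. G u \<bullet> h) \<le> \<eta>"
        using \<eta> by (intro onorm_bound) (auto intro!: order_trans[OF Cauchy_Schwarz_ineq2] mult_right_mono)
    qed auto
    then show "\<bar>g z\<bar> \<le> \<eta> * infdist z (frontier D)"
      using g0[OF q(1)] q(2) by (simp add: dist_norm)
  qed
qed

text \<open>The normal derivative is one-sided and the gradient is relative to the closed domain
  without \<open>w\<close>. Both are compared on a short inward segment of the normal, where the
  chain rule applies and derivatives are unique.\<close>

lemma has_normal_derivative_eq_inner:
  assumes nd: "has_normal_derivative g q n d"
    and g: "(g has_derivative (\<lambda>h. v \<bullet> h)) (at q within closure D - {w})"
    and q: "q \<in> frontier D" "q \<noteq> w"
    and inside: "\<forall>\<^sub>F x in at_right 0. q - of_real x * n \<in> D"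
  shows "d = v \<bullet> n"
proof -
  have "((\<lambda>x. q - of_real x * n) \<longlongrightarrow> q - of_real 0 * n) (at_right (0::real))" by (intro tendsto_intros)
  then have "\<forall>\<^sub>F x in at_right (0::real). q - of_real x * n \<noteq> w"
    using q(2) by (simp add: tendsto_imp_eventually_ne)
  with inside have "\<forall>\<^sub>F x in at_right 0. q - of_real x * n \<in> closure D - {w}"
    by eventually_elim (use closure_subset in auto)
  then obtain \<epsilon> where \<epsilon>: "\<epsilon> > 0" "\<And>x. 0 < x \<Longrightarrow> x < \<epsilon> \<Longrightarrow> q - of_real x * n \<in> closure D - {w}"
    unfolding eventually_at_right_field by auto
  define X where "X = {-(\<epsilon>/2)..0}"
  have img: "(\<lambda>x. q + of_real x * n) ` X \<subseteq> closure D - {w}"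
  proof (rule image_subsetI)
    fix x assume "x \<in> X"
    then show "q + of_real x * n \<in> closure D - {w}"
      using \<epsilon>(2)[of "-x"] \<epsilon>(1) q by (cases "x = 0") (auto simp: X_def frontier_def)
  qed
  have lin: "((\<lambda>x. q + of_real x * n) has_derivative (\<lambda>x. of_real x * n)) (at 0 within X)"
    by (auto intro!: derivative_eq_intros)
  have "(g has_derivative (\<lambda>h. v \<bullet> h)) (at (q + of_real 0 * n) within (\<lambda>x. q + of_real x * n) ` X)"
    using g img by (simp add: has_derivative_subset)
  from has_derivative_in_compose[OF lin this]
  have 1: "((\<lambda>x. g (q + of_real x * n)) has_vector_derivative v \<bullet> n) (at 0 within X)"
    unfolding has_vector_derivative_def by (simp add: scaleR_conv_of_real[symmetric])
  have 2: "((\<lambda>x. g (q + of_real x * n)) has_vector_derivative d) (at 0 within X)"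
    using nd unfolding has_normal_derivative_def has_real_derivative_iff_has_vector_derivative
    by (rule has_vector_derivative_within_subset) (auto simp: X_def)
  have "at 0 within X \<noteq> bot"
    unfolding X_def using \<epsilon>(1) by (simp add: at_within_Icc_at_left trivial_limit_at_left_real)
  then show ?thesis using vector_derivative_unique_within 1 2 by metis
qed

lemma complex_eq_0_if_inner_eq_0:
  assumes "a \<bullet> v = 0" "a \<bullet> (\<i> * v) = 0" "v \<noteq> 0"
  shows "a = 0"
proof -
  have 1: "Re a * Re v + Im a * Im v = 0" "Im a * Re v - Re a * Im v = 0"
    using assms(1,2) by (auto simp: inner_complex_def)
  have "a * cnj v = 0" using 1 by (simp add: complex_eq_iff)
  then show ?thesis using assms(3) by simp
qed

lemma smooth_on_bounded:
  assumes "smooth_on \<Omega> \<kappa>" "compact S" "S \<subseteq> \<Omega>"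
  obtains K where "\<And>z. z \<in> S \<Longrightarrow> \<kappa> differentiable (at z)" "\<And>z. z \<in> S \<Longrightarrow> \<bar>\<kappa> z\<bar> \<le> K"
    "\<And>z. z \<in> S \<Longrightarrow> \<bar>dir_deriv 1 \<kappa> z\<bar> \<le> K" "\<And>z. z \<in> S \<Longrightarrow> \<bar>dir_deriv \<i> \<kappa> z\<bar> \<le> K"
proof -
  have op: "open \<Omega>" and d: "foldr dir_deriv vs \<kappa> differentiable_on \<Omega>" for vs
    using assms(1) by (auto simp: smooth_on_def)
  have bdd: "\<exists>K. \<forall>z\<in>S. \<bar>f z\<bar> \<le> K" if "f differentiable_on \<Omega>" for f :: "complex \<Rightarrow> real"
  proof -
    have "continuous_on S f"
      using differentiable_imp_continuous_on[OF that] assms(3) continuous_on_subset by blast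
    then have "bounded (f ` S)" using assms(2) compact_continuous_image compact_imp_bounded by blast
    then show ?thesis by (auto simp: bounded_iff)
  qed
  obtain K0 where K0: "\<And>z. z \<in> S \<Longrightarrow> \<bar>\<kappa> z\<bar> \<le> K0" using bdd[OF d[of "[]"]] by auto
  obtain K1 where K1: "\<And>z. z \<in> S \<Longrightarrow> \<bar>dir_deriv 1 \<kappa> z\<bar> \<le> K1" using bdd[OF d[of "[1]"]] by auto
  obtain K2 where K2: "\<And>z. z \<in> S \<Longrightarrow> \<bar>dir_deriv \<i> \<kappa> z\<bar> \<le> K2" using bdd[OF d[of "[\<i>]"]] by auto
  have "\<kappa> differentiable (at z)" if "z \<in> S" for z
    using d[of "[]"] that assms(3) op by (auto simp: differentiable_on_eq_differentiable_at)
  then show ?thesis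
    by (rule that[of "max K0 (max K1 K2)"]) (use K0 K1 K2 in \<open>auto simp: le_max_iff_disj\<close>)
qed

text \<open>If \<open>g\<close> and its gradient both vanished on the boundary, the equation could
  formally be tested against the constant 1, giving \<open>0 = 1\<close>. The cutoffs stand in for
  this test function, which does not have compact support in \<open>D\<close>.\<close>

lemma green_function_nonvanishing_gradient:
  assumes D: "bounded_analytic_domain D" and w: "w \<in> D"
    and \<Omega>: "closure D \<subseteq> \<Omega>" "smooth_on \<Omega> \<kappa>"
    and sol: "solves_delta \<kappa> D w g"
    and G: "continuous_on (closure D - {w}) G"
    and g: "\<And>z. z \<in> closure D - {w} \<Longrightarrow> (g has_derivative (\<lambda>h. G z \<bullet> h)) (at z within closure D - {w})"
    and g0: "\<And>z. z \<in> frontier D \<Longrightarrow> g z = 0"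
  obtains q where "q \<in> frontier D" "G q \<noteq> 0"
proof (rule ccontr)
  assume "\<not> thesis"
  then have G0: "\<And>z. z \<in> frontier D \<Longrightarrow> G z = 0" using that by blast
  have D': "open D" "bounded D" "D \<noteq> {}" using D by (auto simp: bounded_analytic_domain_def)
  have ne: "frontier D \<noteq> {}" using D' frontier_not_empty[of D] not_bounded_UNIV by blast
  have "compact (closure D)" using D'(2) by simp
  from smooth_on_bounded[OF \<Omega>(2) this \<Omega>(1)] obtain K where
    K: "\<And>z. z \<in> closure D \<Longrightarrow> \<kappa> differentiable (at z)" "\<And>z. z \<in> closure D \<Longrightarrow> \<bar>\<kappa> z\<bar> \<le> K"
    "\<And>z. z \<in> closure D \<Longrightarrow> \<bar>dir_deriv 1 \<kappa> z\<bar> \<le> K" "\<And>z. z \<in> closure D \<Longrightarrow> \<bar>dir_deriv \<i> \<kappa> z\<bar> \<le> K"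
    by blast
  obtain C where C: "C \<ge> 0" "\<And>\<epsilon>. 0 < \<epsilon> \<Longrightarrow> \<epsilon> \<le> 1 \<Longrightarrow> \<exists>f. test_function D f \<and>
      (\<forall>z\<in>D. \<bar>div_grad \<kappa> f z\<bar> \<le> C / \<epsilon>\<^sup>2) \<and>
      (\<forall>z. ball z (6 * \<epsilon>) \<subseteq> D \<longrightarrow> f z = 1 \<and> div_grad \<kappa> f z = 0)"
    by (rule grid_cutoff[OF D'(1,2) K[OF subsetD[OF closure_subset]]]) (assumption | rule that)+
  obtain C' where C': "C' \<ge> 0" "\<And>\<delta>. 0 < \<delta> \<Longrightarrow> \<delta> \<le> 1 \<Longrightarrow>
     \<exists>E. E \<in> lmeasurable \<and> measure lebesgue E \<le> C' * \<delta> \<and> (\<forall>q\<in>frontier D. cball q \<delta> \<subseteq> E)"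
    using linear_collar_analytic_boundary[OF D] unfolding linear_collar_def by blast
  \<comment> \<open>One factor 6 comes from the bound on \<open>g\<close> at distance
    \<open>6 * \<epsilon>\<close>, the other from the area of the collar of that width. The added 1
    makes the final product strictly less than 1.\<close>
  define \<eta> where "\<eta> = 1 / (36 * C * C' + 1)"
  have pos: "36 * C * C' \<ge> 0" using C C' by simp
  then have \<eta>: "\<eta> > 0" unfolding \<eta>_def by (intro divide_pos_pos) linarith+
  obtain d where d: "d > 0" "\<And>z. z \<in> D \<Longrightarrow> infdist z (frontier D) < d \<Longrightarrow>
      \<bar>g z\<bar> \<le> \<eta> * infdist z (frontier D)"
    by (rule small_near_frontier[OF D'(1,2) w G g g0 G0 ne \<eta>]) (assumption | rule that)+
  have "w \<notin> frontier D" using D' w by (simp add: frontier_def interior_open)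
  then have wpos: "infdist w (frontier D) > 0"
    using in_closed_iff_infdist_zero[OF frontier_closed ne] infdist_nonneg[of w "frontier D"] by force
  \<comment> \<open>The width \<open>6 * \<epsilon>\<close> must be admissible for the collar, lie
    within the range where \<open>g\<close> is small, and leave \<open>w\<close> where the cutoff
    equals 1.\<close>
  define \<epsilon> where "\<epsilon> = min 1 (min d (infdist w (frontier D))) / 6"
  have \<epsilon>: "\<epsilon> > 0" "\<epsilon> \<le> 1" "6 * \<epsilon> \<le> 1" "6 * \<epsilon> \<le> d" "6 * \<epsilon> \<le> infdist w (frontier D)"
    using d(1) wpos by (auto simp: \<epsilon>_def min_def)
  obtain f where f: "test_function D f" "\<And>z. z \<in> D \<Longrightarrow> \<bar>div_grad \<kappa> f z\<bar> \<le> C / \<epsilon>\<^sup>2"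
    "\<And>z. ball z (6 * \<epsilon>) \<subseteq> D \<Longrightarrow> f z = 1 \<and> div_grad \<kappa> f z = 0"
    using C(2)[OF \<epsilon>(1,2)] by blast
  have "0 < 6 * \<epsilon>" using \<epsilon>(1) by simp
  from C'(2)[OF this \<epsilon>(3)] obtain E where E: "E \<in> lmeasurable" "measure lebesgue E \<le> C' * (6 * \<epsilon>)"
    "\<And>q. q \<in> frontier D \<Longrightarrow> cball q (6 * \<epsilon>) \<subseteq> E" by blast
  have "f w = 1" using f(3) ball_subset_if_le_infdist_frontier[OF w \<epsilon>(5)] by blast
  then have one: "(LINT z:D|lebesgue. g z * div_grad \<kappa> f z) = 1"
    using sol f(1) unfolding solves_delta_def by metis
  define F where "F z = indicator D z *\<^sub>R (g z * div_grad \<kappa> f z)" for z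
  have intF: "(\<integral>z. F z \<partial>lebesgue) = 1" using one unfolding set_lebesgue_integral_def F_def .
  \<comment> \<open>A function that is not integrable has integral 0 by convention, so the value 1
    forces integrability.\<close>
  then have "integrable lebesgue F" using not_integrable_integral_eq by fastforce
  define M where "M = \<eta> * (6 * \<epsilon>) * (C / \<epsilon>\<^sup>2)"
  have M: "M \<ge> 0" using \<eta> \<epsilon> C by (simp add: M_def)
  have le: "\<bar>F z\<bar> \<le> M * indicator E z" for z
  proof (cases "z \<in> D \<and> infdist z (frontier D) < 6 * \<epsilon>")
    case True
    then have z: "z \<in> D" "infdist z (frontier D) < 6 * \<epsilon>" by auto
    obtain q where q: "q \<in> frontier D" "infdist z (frontier D) = dist z q"
      using infdist_attains_inf[OF frontier_closed ne] by metis
    then have "z \<in> E" using E(3)[OF q(1)] z(2) by (auto simp: dist_commute)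
    have "\<bar>g z\<bar> \<le> \<eta> * infdist z (frontier D)" using d(2) z \<epsilon>(4) by simp
    also have "\<dots> \<le> \<eta> * (6 * \<epsilon>)" using z \<eta> by (intro mult_left_mono) auto
    finally have "\<bar>g z\<bar> * \<bar>div_grad \<kappa> f z\<bar> \<le> M"
      unfolding M_def using f(2)[OF z(1)] \<eta> \<epsilon> by (intro mult_mono) auto
    then show ?thesis using z \<open>z \<in> E\<close> by (simp add: F_def abs_mult)
  next
    case False
    \<comment> \<open>Outside the collar no bound on \<open>g\<close> is at hand, but there the
      cutoff is locally constant, so the other factor vanishes.\<close>
    have "F z = 0"
    proof (cases "z \<in> D")
      case True
      with False have "ball z (6 * \<epsilon>) \<subseteq> D" by (intro ball_subset_if_le_infdist_frontier) auto
      then show ?thesis using f(3) by (simp add: F_def)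
    qed (simp add: F_def)
    then show ?thesis using M by simp
  qed
  have intE: "integrable lebesgue (\<lambda>z. M * indicator E z)"
    using E(1) by (intro integrable_mult_right integrable_real_indicator) (auto simp: fmeasurable_def)
  have "1 \<le> (\<integral>z. M * indicator E z \<partial>lebesgue)"
    unfolding intF[symmetric]
    by (rule integral_mono[OF \<open>integrable lebesgue F\<close> intE]) (use le abs_le_D1 in blast)
  also have "\<dots> = M * measure lebesgue E" using E(1) by simp
  also have "\<dots> \<le> M * (C' * (6 * \<epsilon>))" using E(2) M by (rule mult_left_mono)
  also have "\<dots> = \<eta> * (36 * C * C')" using \<epsilon>(1) by (simp add: M_def field_simps power2_eq_square)
  also have "\<dots> < 1" unfolding \<eta>_def using pos by (simp only: times_divide_eq_left mult_1_left divide_less_eq_1) linarith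
  finally show False by simp
qed

section \<open>Contradiction at one boundary point\<close>

theorem theorem4p3:
  fixes D :: "real \<Rightarrow> complex set" and t0 :: real
  assumes domains: "\<And>t. 0 \<le> t \<Longrightarrow> bounded_analytic_domain (D t)"
    and growing: "\<And>s t. 0 \<le> s \<Longrightarrow> s \<le> t \<Longrightarrow> D s \<subseteq> D t"
    and t0: "0 \<le> t0"
    and area: "((\<lambda>t. measure lebesgue (D t)) has_real_derivative 0) (at t0 within {0..})"
  shows "\<not> (\<exists>\<kappa> w. elliptic_growth D \<kappa> w)"
proof
  assume "\<exists>\<kappa> w. elliptic_growth D \<kappa> w"
  then obtain \<kappa> w where eg: "elliptic_growth D \<kappa> w" by blast
  let ?D = "D t0"
  have op: "open (D t)" and bd: "bounded (D t)" if "0 \<le> t" for t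
    using domains[OF that] by (auto simp: bounded_analytic_domain_def)
  have "permeability D \<kappa>" and w: "w \<in> ?D"
    and "\<exists>g. green_function \<kappa> ?D w g \<and>
        (\<forall>p\<in>frontier ?D. \<exists>n v d. outward_unit_normal ?D p n \<and>
           has_normal_velocity D t0 p n v \<and> has_normal_derivative g p n d \<and> v = \<kappa> p * d)"
    using eg t0 unfolding elliptic_growth_def by simp_all
  then obtain \<Omega> g where "\<forall>t\<ge>0. closure (D t) \<subseteq> \<Omega>" and \<Omega>': "smooth_on \<Omega> \<kappa>" "\<forall>z\<in>\<Omega>. \<kappa> z > 0"
    and green: "green_function \<kappa> ?D w g"
    and flow: "\<forall>p\<in>frontier ?D. \<exists>n v d. outward_unit_normal ?D p n \<and>
           has_normal_velocity D t0 p n v \<and> has_normal_derivative g p n d \<and> v = \<kappa> p * d"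
    unfolding permeability_def by (elim exE conjE) (rule that)
  then have \<Omega>: "closure ?D \<subseteq> \<Omega>" "smooth_on \<Omega> \<kappa>" "\<And>z. z \<in> \<Omega> \<Longrightarrow> \<kappa> z > 0" using t0 by auto
  obtain G where G: "continuous_on (closure ?D - {w}) G"
    and g: "\<And>z. z \<in> closure ?D - {w} \<Longrightarrow> (g has_derivative (\<lambda>h. G z \<bullet> h)) (at z within closure ?D - {w})"
    using green unfolding green_function_def C1_on_def by blast
  have g0: "g z = 0" if "z \<in> frontier ?D" for z using green that by (auto simp: green_function_def)
  have fr: "frontier ?D \<subseteq> closure ?D - {w}"
    using w op[OF t0] by (auto simp: frontier_def interior_open)
  \<comment> \<open>Fixing a point with nonzero gradient makes the rest local: one chart around
    \<open>p\<close> is enough.\<close>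
  obtain p where p: "p \<in> frontier ?D" "G p \<noteq> 0"
    using green_function_nonvanishing_gradient[OF domains[OF t0] w \<Omega>(1,2) _ G g g0] green
    unfolding green_function_def by metis
  obtain U \<phi> where chart: "boundary_chart ?D p U \<phi>"
    using domains[OF t0] p(1) unfolding bounded_analytic_domain_def analytic_boundary_def by blast
  have U: "open U" "p \<in> U" and hol: "\<phi> holomorphic_on U" using chart by (auto simp: boundary_chart_def)
  \<comment> \<open>The growth law supplies a normal and a velocity separately at each point. Taking
    all normals from one chart and writing the velocity as
    \<open>\<kappa> q * (G q \<bullet> n q)\<close> makes both continuous; uniqueness of the normal
    identifies them with those of the flow.\<close>
  define n where "n q = - sgn (\<i> * cnj (deriv \<phi> q))" for q
  define V where "V q = \<kappa> q * (G q \<bullet> n q)" for q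
  have chq: "boundary_chart ?D q U \<phi>" if "q \<in> U" for q
    using chart that by (simp add: boundary_chart_def)
  have inside: "\<forall>\<^sub>F x in at_right 0. q - of_real x * n q \<in> ?D" if q: "q \<in> frontier ?D \<inter> U" for q
  proof -
    have c: "boundary_chart ?D q U \<phi>" using chq q by blast
    have "(\<i> * cnj (deriv \<phi> q)) \<bullet> (- n q) > 0"
      using boundary_chart_deriv(2)[OF c] by (simp add: n_def sgn_div_norm norm_mult)
    with boundary_chart_direction(1)[OF c boundary_chart_Im_eq_0[OF c op[OF t0]]] q
    have "\<forall>\<^sub>F x in at_right 0. q + of_real x * (- n q) \<in> ?D" by blast
    then show ?thesis by simp
  qed
  have vel: "has_normal_velocity D t0 q n' (V q)"
    if q: "q \<in> frontier ?D \<inter> U" and n': "outward_unit_normal ?D q n'" for q n'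
  proof -
    have c: "boundary_chart ?D q U \<phi>" using chq q by blast
    have uniq: "m = n q" if "outward_unit_normal ?D q m" for m
      unfolding n_def using outward_unit_normal_unique[OF c op[OF t0] _ that] q by blast
    obtain v d where vd: "has_normal_velocity D t0 q (n q) v" "has_normal_derivative g q (n q) d" "v = \<kappa> q * d"
      using bspec[OF flow, of q] q uniq by blast
    have "d = G q \<bullet> n q"
      by (rule has_normal_derivative_eq_inner[OF vd(2) g]) (use fr q inside in auto)
    then show ?thesis using vd uniq[OF n'] by (simp add: V_def)
  qed
  have contV: "continuous_on (frontier ?D \<inter> U) V"
  proof -
    have "continuous_on (frontier ?D \<inter> U) \<kappa>"
    proof -
      have "\<kappa> differentiable_on \<Omega>" using \<Omega>(2) unfolding smooth_on_def by (metis foldr.simps(1) id_apply)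
      then show ?thesis
        using differentiable_imp_continuous_on continuous_on_subset fr \<Omega>(1) by (metis Diff_subset Int_lower1 order_trans)
    qed
    moreover have "continuous_on (frontier ?D \<inter> U) G" using G fr continuous_on_subset by blast
    moreover have "continuous_on (frontier ?D \<inter> U) (deriv \<phi>)"
      using holomorphic_on_imp_continuous_on[OF holomorphic_deriv[OF hol U(1)]] continuous_on_subset by blast
    moreover have "\<forall>q\<in>frontier ?D \<inter> U. deriv \<phi> q \<noteq> 0" using boundary_chart_deriv(2)[OF chq] by blast
    ultimately show ?thesis unfolding V_def n_def by (intro continuous_intros) auto
  qed
  have "V p \<le> 0"
    by (rule boundary_velocity_le_0[OF op bd growing t0 area chart p(1) contV vel])
  moreover have "0 \<le> V p"
  proof (rule has_normal_velocity_nonneg[OF vel t0])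
    show "outward_unit_normal ?D p (n p)" using chart by (auto simp: outward_unit_normal_def n_def)
  qed (use p U inside growing t0 in auto)
  moreover have "\<kappa> p > 0" using \<Omega> fr p(1) by blast
  ultimately have normal: "G p \<bullet> n p = 0" by (simp add: V_def)
  obtain \<psi> a e where a: "a > 0" and \<psi>: "\<psi> holomorphic_on ball 0 a" "\<psi> 0 = p"
    and nz: "\<And>z. z \<in> ball 0 a \<Longrightarrow> deriv \<psi> z \<noteq> 0"
    and bdry: "\<And>x. \<bar>x\<bar> < a \<Longrightarrow> \<psi> (of_real x) \<in> frontier ?D"
    and nrm: "\<And>x. \<bar>x\<bar> < a \<Longrightarrow> - sgn (\<i> * cnj (deriv \<phi> (\<psi> (of_real x)))) = - (\<i> * sgn (deriv \<psi> (of_real x)))"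
    using boundary_parametrization[OF chart op[OF t0] p(1)] by (metis (no_types, lifting))
  define \<tau> where "\<tau> = deriv \<psi> 0"
  have \<tau>: "\<tau> \<noteq> 0" using nz a by (simp add: \<tau>_def)
  have "n p = - (\<i> * sgn \<tau>)" using nrm[of 0] a by (simp add: n_def \<tau>_def \<psi>(2))
  then have "G p \<bullet> (\<i> * sgn \<tau>) = 0" using normal by simp
  \<comment> \<open>The tangential component: \<open>g\<close> is constantly 0 along the boundary
    curve \<open>\<psi>\<close>.\<close>
  moreover have "G p \<bullet> sgn \<tau> = 0"
  proof -
    have "0 \<in> {-a<..<a}" using a by simp
    then have zero: "at 0 within {-a<..<a} = at 0" by (rule at_within_open) (rule open_greaterThanLessThan)
    have d\<psi>: "(\<psi> has_field_derivative \<tau>) (at (of_real 0))"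
      using holomorphic_derivI[OF \<psi>(1) open_ball, of 0] a by (simp add: \<tau>_def)
    have "((\<lambda>x. complex_of_real x) has_vector_derivative 1) (at 0 within {-a<..<a})"
      by (auto intro!: derivative_eq_intros)
    from field_vector_diff_chain_within[OF this has_field_derivative_at_within[OF d\<psi>]]
    have "((\<lambda>x. \<psi> (of_real x)) has_derivative (\<lambda>x. of_real x * \<tau>)) (at 0 within {-a<..<a})"
      by (simp add: o_def has_vector_derivative_def scaleR_conv_of_real)
    \<comment> \<open>The gradient of \<open>g\<close> at \<open>p\<close> is only relative to
      \<open>closure ?D - {w}\<close>, so the chain rule is applied within the image of the curve,
      which lies in that set.\<close>
    moreover have "(g has_derivative (\<lambda>h. G p \<bullet> h)) (at (\<psi> (of_real 0)) within (\<lambda>x. \<psi> (of_real x)) ` {-a<..<a})"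
    proof -
      have "(\<lambda>x. \<psi> (of_real x)) ` {-a<..<a} \<subseteq> closure ?D - {w}"
      proof (rule image_subsetI)
        fix x assume "x \<in> {-a<..<a}"
        then have "\<psi> (of_real x) \<in> frontier ?D" by (intro bdry) auto
        then show "\<psi> (of_real x) \<in> closure ?D - {w}" using fr by blast
      qed
      then show ?thesis using g[of p] fr p(1) \<psi>(2) by (auto intro: has_derivative_subset)
    qed
    ultimately have "((\<lambda>x. g (\<psi> (of_real x))) has_derivative (\<lambda>x. G p \<bullet> (of_real x * \<tau>))) (at 0 within {-a<..<a})"
      by (rule has_derivative_in_compose)
    then have "((\<lambda>x. g (\<psi> (of_real x))) has_derivative (\<lambda>x. G p \<bullet> (of_real x * \<tau>))) (at 0)"
      unfolding zero .
    moreover have "((\<lambda>x. g (\<psi> (of_real x))) has_derivative (\<lambda>x. 0)) (at 0)"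
      by (rule has_derivative_transform_within_open[OF has_derivative_const[of 0], of "{-a<..<a}"])
         (use a bdry g0 in auto)
    ultimately have "(\<lambda>x. G p \<bullet> (of_real x * \<tau>)) = (\<lambda>x::real. 0)" by (rule has_derivative_unique)
    from fun_cong[OF this, of 1] show ?thesis by (simp add: sgn_div_norm)
  qed
  ultimately have "G p = 0" using \<tau> by (intro complex_eq_0_if_inner_eq_0[of _ "sgn \<tau>"]) (auto simp: sgn_zero_iff)
  then show False using p(2) by simp
qed

end
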